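(* There exist universal constants $c_1, c_2 > 0$ such that the following holds. Let $\Omega \subset \mathbb{R}^2$ be a bounded convex planar domain, and let $u$ be the solution of $$-\Delta u = 1 \quad \text{in } \Omega, \qquad u = 0 \quad \text{on } \partial\Omega.$$ If $u$ assumes its maximum in $x_0 \in \Omega$, then $$\lambda_{\max}\left(D^2u(x_0)\right) \leq -c_1 \exp\left(-c_2 \frac{\operatorname{diam}(\Omega)}{\operatorname{inrad}(\Omega)}\right).$$
   Context: A domain is a nonempty connected open set. $D^2u(x_0)$ is the Hessian matrix of $u$ at $x_0$ and $\lambda_{\max}$ denotes its largest eigenvalue. $\operatorname{diam}(\Omega)$ is the diameter of $\Omega$ and $\operatorname{inrad}(\Omega)$ is its inradius, i.e. the supremum of the radii of disks contained in $\Omega$. The solution $u$ (the torsion function) is the unique function continuous on $\overline{\Omega}$ and $C^2$ in $\Omega$ satisfying the boundary value problem. "Universal" means that $c_1, c_2$ do not depend on $\Omega$. *)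

theory Defs
  imports "HOL-Analysis.Analysis"
begin

definition partial_deriv :: "'n \<Rightarrow> (real ^ 'n \<Rightarrow> real) \<Rightarrow> real ^ 'n \<Rightarrow> real" where
  "partial_deriv i f x = frechet_derivative f (at x) (axis i 1)"

text \<open>The next two predicates are meant for open \<open>S\<close>; the derivatives are then two-sided.\<close>

definition C1_on :: "(real ^ 'n) set \<Rightarrow> (real ^ 'n \<Rightarrow> real) \<Rightarrow> bool" where
  "C1_on S f \<longleftrightarrow>
     (\<forall>x\<in>S. f differentiable (at x)) \<and> (\<forall>i. continuous_on S (partial_deriv i f))"

definition C2_on :: "(real ^ 'n) set \<Rightarrow> (real ^ 'n \<Rightarrow> real) \<Rightarrow> bool" where
  "C2_on S f \<longleftrightarrow> C1_on S f \<and> (\<forall>i. C1_on S (partial_deriv i f))"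

definition hessian :: "(real ^ 'n \<Rightarrow> real) \<Rightarrow> real ^ 'n \<Rightarrow> real ^ 'n ^ 'n" where
  "hessian f x = (\<chi> i j. partial_deriv i (partial_deriv j f) x)"

definition laplacian :: "(real ^ 'n \<Rightarrow> real) \<Rightarrow> real ^ 'n \<Rightarrow> real" where
  "laplacian f x = (\<Sum>i\<in>UNIV. partial_deriv i (partial_deriv i f) x)"

definition eigenvalue :: "real ^ 'n ^ 'n \<Rightarrow> real \<Rightarrow> bool" where
  "eigenvalue A l \<longleftrightarrow> (\<exists>v. v \<noteq> 0 \<and> A *v v = l *\<^sub>R v)"

text \<open>Only used for symmetric matrices, whose set of real eigenvalues is finite and nonempty,
  so that \<open>Max\<close> is the actual maximum.\<close>

definition lambda_max :: "real ^ 'n ^ 'n \<Rightarrow> real" where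
  "lambda_max A = Max {l. eigenvalue A l}"

definition inrad :: "'a::metric_space set \<Rightarrow> real" where
  "inrad S = Sup {r. r > 0 \<and> (\<exists>c. ball c r \<subseteq> S)}"

definition planar_domain :: "(real ^ 2) set \<Rightarrow> bool" where
  "planar_domain \<Omega> \<longleftrightarrow> \<Omega> \<noteq> {} \<and> open \<Omega> \<and> connected \<Omega>"

definition torsion_function :: "(real ^ 2) set \<Rightarrow> (real ^ 2 \<Rightarrow> real) \<Rightarrow> bool" where
  "torsion_function \<Omega> u \<longleftrightarrow>
     continuous_on (closure \<Omega>) u \<and> C2_on \<Omega> u \<and>
     (\<forall>x\<in>\<Omega>. - laplacian u x = 1) \<and> (\<forall>x\<in>frontier \<Omega>. u x = 0)"

end

theory Submission
  imports Defs "HOL-Complex_Analysis.Complex_Analysis"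
begin

text \<open>
  In complex coordinates centred at the maximum point, with the real axis along the eigenvector of the
  largest eigenvalue \<open>-a\<close> of the Hessian, \<open>u = M - y\<^sup>2 / 2 + Re (z\<^sup>2 g(z))\<close> with \<open>g\<close>
  holomorphic and \<open>g 0 = -a / 2\<close>. On the boundary, \<open>Re (z\<^sup>2 g(z))\<close> equals
  \<open>f = (y\<^sup>2 - h\<^sup>2) / 2\<close>, where \<open>h\<^sup>2 = 2 M\<close>. Transplant everything to the unit disc by a Riemann map
  \<open>\<psi>\<close>. Since the domain is convex, \<open>Im \<psi>\<close> is unimodal on every circle, so the level sets
  \<open>y = h\<close> and \<open>y = -h\<close> produce at most four sign changes of \<open>f\<close>, and some product \<open>T\<close> of four half-angle
  sines satisfies \<open>f T \<ge> 0\<close>. As \<open>T\<close> is a trigonometric polynomial of degree two, the mean of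
  \<open>f T\<close> only sees the second Taylor coefficient, hence is at most a multiple of \<open>a diam\<^sup>2\<close>. Conversely it is bounded below by
  a power of the mean of \<open>|f|\<close>, and this mean is at least of order \<open>h\<^sup>2 exp (- \<pi> diam / (2 h))\<close> because the harmonic
  function \<open>Re (cosh (\<pi> z / (2 h)))\<close> vanishes where \<open>f\<close> does but equals \<open>1\<close> at the origin. Finally \<open>M\<close> is
  at least a quarter of the squared inradius.
\<close>

no_notation fps_nth (infixl "$" 75)

section \<open>Means over the unit circle\<close>

text \<open>Cauchy's integral formula at the centre, with \<open>2 * pi * \<i>\<close> cancelled
  against the derivative of the circle path.\<close>

lemma circle_mean_holomorphic:
  assumes "continuous_on (cball 0 1) F" "F holomorphic_on ball 0 1"
  shows "((\<lambda>t. F (cis (2 * pi * t))) has_integral F 0) {0..1}"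
proof -
  have "((\<lambda>u. F u / (u - 0)) has_contour_integral 2 * of_real pi * \<i> * F 0) (circlepath 0 1)"
    by (rule Cauchy_integral_circlepath) (use assms in auto)
  hence "((\<lambda>t. F (circlepath 0 1 t) / circlepath 0 1 t *
           vector_derivative (circlepath 0 1) (at t within {0..1})) has_integral 2 * of_real pi * \<i> * F 0) {0..1}"
    by (simp add: has_contour_integral_def)
  hence "((\<lambda>t. (2 * of_real pi * \<i>) * F (cis (2 * pi * t))) has_integral 2 * of_real pi * \<i> * F 0) {0..1}"
  proof (rule has_integral_eq[rotated])
    fix t :: real assume t: "t \<in> {0..1}"
    have e: "circlepath 0 1 t = cis (2 * pi * t)"
      by (simp add: circlepath cis_conv_exp mult_ac)
    show "F (circlepath 0 1 t) / circlepath 0 1 t * vector_derivative (circlepath 0 1) (at t within {0..1})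
        = (2 * of_real pi * \<i>) * F (cis (2 * pi * t))"
      using t by (simp add: vector_derivative_circlepath01 e) (simp add: cis_conv_exp mult_ac)
  qed
  hence "((\<lambda>t. inverse (2 * of_real pi * \<i>) * ((2 * of_real pi * \<i>) * F (cis (2 * pi * t)))) has_integral
     inverse (2 * of_real pi * \<i>) * (2 * of_real pi * \<i> * F 0)) {0..1}"
    by (rule has_integral_mult_right)
  thus ?thesis
    by (simp add: field_simps)
qed

lemma has_integral_Re_complex:
  "(f has_integral y) S \<Longrightarrow> ((\<lambda>t. Re (f t)) has_integral Re y) S"
  using has_integral_linear[OF _ bounded_linear_Re] by (auto simp: o_def)

section \<open>Poisson kernels in half-angle form\<close>

lemma one_minus_cis_norm_sq:
  "(cmod (1 - of_real \<rho> * cis x))\<^sup>2 = (1 - \<rho>)\<^sup>2 + 4 * \<rho> * (sin (x / 2))\<^sup>2"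
proof -
  have "cos x = 1 - 2 * (sin (x/2))\<^sup>2"
    using cos_double_sin[of "x/2"] by simp
  moreover have "(sin x)\<^sup>2 = 1 - (cos x)\<^sup>2" by (simp add: sin_squared_eq)
  ultimately show ?thesis
    unfolding cmod_power2 by (simp add: power_mult_distrib) (simp add: algebra_simps power2_eq_square)
qed

text \<open>The kernel is the real part of \<open>(1 + w) / (1 - w)\<close> with
  \<open>w = \<rho> * cis (\<theta> - \<alpha>)\<close>, hence the boundary value of a holomorphic
  function with value 1 at the centre. The half-angle denominator lets the kernel be compared with
  the sine factors used below.\<close>

lemma Poisson_kernel_mean:
  assumes "0 \<le> \<rho>" "\<rho> < 1"
  shows "((\<lambda>t. (1 - \<rho>\<^sup>2) / ((1 - \<rho>)\<^sup>2 + 4 * \<rho> * (sin ((2 * pi * t - \<alpha>) / 2))\<^sup>2)) has_integral 1) {0..1}"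
proof -
  define F where "F = (\<lambda>z. (1 + of_real \<rho> * cis (-\<alpha>) * z) / (1 - of_real \<rho> * cis (-\<alpha>) * z))"
  have nz: "1 - of_real \<rho> * cis (-\<alpha>) * z \<noteq> 0" if "z \<in> cball 0 1" for z
  proof
    assume "1 - of_real \<rho> * cis (-\<alpha>) * z = 0"
    hence "cmod (of_real \<rho> * cis (-\<alpha>) * z) = 1" by simp
    hence "\<rho> * cmod z = 1" using assms by (simp add: norm_mult)
    moreover have "\<rho> * cmod z \<le> \<rho> * 1" using that assms by (intro mult_left_mono) auto
    ultimately show False using assms by simp
  qed
  have "((\<lambda>t. F (cis (2 * pi * t))) has_integral F 0) {0..1}"
    unfolding F_def using nz
    by (intro circle_mean_holomorphic continuous_intros holomorphic_intros) auto
  hence "((\<lambda>t. Re (F (cis (2 * pi * t)))) has_integral Re (F 0)) {0..1}"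
    by (rule has_integral_Re_complex)
  moreover have "Re (F (cis \<theta>)) = (1 - \<rho>\<^sup>2) / ((1 - \<rho>)\<^sup>2 + 4 * \<rho> * (sin ((\<theta> - \<alpha>) / 2))\<^sup>2)" for \<theta>
  proof -
    let ?w = "of_real \<rho> * cis (\<theta> - \<alpha>)"
    have "F (cis \<theta>) = (1 + ?w) / (1 - ?w)"
      unfolding F_def by (simp add: cis_mult mult.assoc)
    also have "Re \<dots> = Re ((1 + ?w) * cnj (1 - ?w)) / (cmod (1 - ?w))\<^sup>2"
      by (subst complex_div_cnj) (simp only: of_real_power[symmetric] Re_divide_of_real)
    also have "Re ((1 + ?w) * cnj (1 - ?w)) = 1 - \<rho>\<^sup>2"
    proof -
      have "(sin (\<theta>-\<alpha>))\<^sup>2 = 1 - (cos (\<theta>-\<alpha>))\<^sup>2" by (simp add: sin_squared_eq)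
      thus ?thesis by (simp add: algebra_simps power2_eq_square)
    qed
    finally show ?thesis by (simp only: one_minus_cis_norm_sq)
  qed
  ultimately show ?thesis by (simp add: F_def)
qed

text \<open>At radius \<open>1 - 2 * \<epsilon>\<close> the numerator is
  \<open>4 * \<epsilon> * (1 - \<epsilon>)\<close>, at least \<open>2 * \<epsilon>\<close>, while
  the denominator is at most \<open>8 * \<epsilon>\<^sup>2\<close> for a sine of size at most
  \<open>\<epsilon>\<close>. The quotient is therefore at least
  \<open>1 / (4 * \<epsilon>)\<close>.\<close>

lemma Poisson_kernel_ge:
  fixes \<epsilon> s :: real
  assumes "0 < \<epsilon>" "\<epsilon> \<le> 1/2" "\<bar>s\<bar> \<le> \<epsilon>"
  shows "1 \<le> 4 * \<epsilon> * ((1 - (1 - 2*\<epsilon>)\<^sup>2) / ((1 - (1 - 2*\<epsilon>))\<^sup>2 + 4 * (1 - 2*\<epsilon>) * s\<^sup>2))"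
proof -
  have s: "s\<^sup>2 \<le> \<epsilon>\<^sup>2" using assms by (intro power2_le_iff_abs_le[THEN iffD2]) auto
  have "4 * (1 - 2*\<epsilon>) * s\<^sup>2 \<le> 4 * 1 * \<epsilon>\<^sup>2" using assms s by (intro mult_mono) auto
  hence d: "(1 - (1 - 2*\<epsilon>))\<^sup>2 + 4 * (1 - 2*\<epsilon>) * s\<^sup>2 \<le> 8 * \<epsilon>\<^sup>2" (is "?d \<le> _")
    by (simp add: power2_eq_square)
  have "0 \<le> 4 * (1 - 2*\<epsilon>) * s\<^sup>2" using assms by simp
  moreover have "(1 - (1 - 2*\<epsilon>))\<^sup>2 > 0" using assms by simp
  ultimately have dp: "?d > 0" by linarith
  have "8 * \<epsilon>\<^sup>2 \<le> 16 * \<epsilon>\<^sup>2 * (1 - \<epsilon>)"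
  proof -
    have "16 * \<epsilon>\<^sup>2 * (1/2) \<le> 16 * \<epsilon>\<^sup>2 * (1 - \<epsilon>)" using assms by (intro mult_left_mono) auto
    thus ?thesis by simp
  qed
  also have "\<dots> = 4 * \<epsilon> * (1 - (1 - 2*\<epsilon>)\<^sup>2)" by (simp add: algebra_simps power2_eq_square)
  finally have "?d \<le> 4 * \<epsilon> * (1 - (1 - 2*\<epsilon>)\<^sup>2)" using d by linarith
  thus ?thesis using dp by (simp add: field_simps)
qed

text \<open>The product of sines is small only near its four zeros, where Poisson kernels
  \<open>4 \<epsilon> P\<close> of small mean dominate the constant \<open>1\<close>.\<close>
lemma circle_mean_times_sines_ge:
  fixes f :: "real \<Rightarrow> real"
  assumes cont: "continuous_on UNIV f" and B: "\<And>\<theta>. \<bar>f \<theta>\<bar> \<le> B"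
    and A: "A \<le> integral {0..1} (\<lambda>t. \<bar>f (2 * pi * t)\<bar>)" "0 < A"
  shows "A ^ 5 / (2 * 32 ^ 4 * B ^ 4) \<le>
    integral {0..1} (\<lambda>t. \<bar>f (2 * pi * t)\<bar> *
       \<bar>sin ((2 * pi * t - a) / 2) * sin ((2 * pi * t - b) / 2) * sin ((2 * pi * t - c) / 2) * sin ((2 * pi * t - d) / 2)\<bar>)"
    (is "_ \<le> integral _ ?fT")
proof -
  have cf: "continuous_on S (\<lambda>t. f (2 * pi * t))" for S
    by (intro continuous_on_compose2[OF cont] continuous_intros) auto
  have "integral {0..1} (\<lambda>t. \<bar>f (2 * pi * t)\<bar>) \<le> integral {0..1} (\<lambda>t::real. B)"
    by (intro integral_le integrable_continuous_interval continuous_intros cf B)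
  hence AB: "A \<le> B" using A by simp
  hence Bp: "0 < B" using A by linarith
  \<comment> \<open>Each of the four terms \<open>4 * \<epsilon> * B * P\<close> has mean
    \<open>4 * \<epsilon> * B\<close>; together they cost
    \<open>16 * \<epsilon> * B = A / 2\<close>, half of the available mean.\<close>
  define \<epsilon> where "\<epsilon> = A / (32 * B)"
  have e: "0 < \<epsilon>" "\<epsilon> \<le> 1/32" using A Bp AB by (auto simp: \<epsilon>_def field_simps)
  define P where "P = (\<lambda>\<alpha> t. (1 - (1 - 2*\<epsilon>)\<^sup>2) / ((1 - (1 - 2*\<epsilon>))\<^sup>2 + 4 * (1 - 2*\<epsilon>) * (sin ((2 * pi * t - \<alpha>) / 2))\<^sup>2))"
  have P: "(P \<alpha> has_integral 1) {0..1}" for \<alpha>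
    unfolding P_def by (rule Poisson_kernel_mean) (use e in auto)
  have Pnn: "0 \<le> P \<alpha> t" for \<alpha> t
  proof -
    have "(1 - 2*\<epsilon>)\<^sup>2 \<le> 1" using e by (simp add: power_le_one)
    thus ?thesis unfolding P_def using e by (intro divide_nonneg_nonneg add_nonneg_nonneg) auto
  qed
  have Pge: "1 \<le> 4 * \<epsilon> * P \<alpha> t" if "\<bar>sin ((2 * pi * t - \<alpha>) / 2)\<bar> \<le> \<epsilon>" for \<alpha> t
    unfolding P_def by (rule Poisson_kernel_ge) (use e that in auto)
  have iT: "?fT integrable_on {0..1}"
    by (intro integrable_continuous_interval continuous_intros cf) auto
  have pw: "\<bar>f (2 * pi * t)\<bar> \<le> ?fT t * (1 / \<epsilon>^4) + 4 * \<epsilon> * B * (P a t + P b t + P c t + P d t)" for t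
  proof -
    let ?s = "\<lambda>\<alpha>. \<bar>sin ((2 * pi * t - \<alpha>) / 2)\<bar>"
    define X where "X = ?fT t * (1 / \<epsilon>^4)"
    define Q where "Q = (\<lambda>\<alpha>. 4 * \<epsilon> * B * P \<alpha> t)"
    have sumQ: "4 * \<epsilon> * B * (P a t + P b t + P c t + P d t) = Q a + Q b + Q c + Q d"
      by (simp add: Q_def algebra_simps)
    have nn: "0 \<le> Q \<alpha>" for \<alpha> using e Bp Pnn by (simp add: Q_def)
    have nn': "0 \<le> X" using e by (simp add: X_def)
    have "\<bar>f (2 * pi * t)\<bar> \<le> X + (Q a + Q b + Q c + Q d)"
    proof (cases "\<exists>\<alpha>\<in>{a,b,c,d}. ?s \<alpha> \<le> \<epsilon>")
      case True
      then obtain \<alpha> where \<alpha>: "\<alpha> \<in> {a,b,c,d}" "?s \<alpha> \<le> \<epsilon>" by blast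
      have "B * 1 \<le> B * (4 * \<epsilon> * P \<alpha> t)"
        using Pge[OF \<alpha>(2)] Bp by (intro mult_left_mono) auto
      hence "B \<le> Q \<alpha>" by (simp add: Q_def mult_ac)
      moreover have "Q \<alpha> \<le> Q a + Q b + Q c + Q d"
        using \<alpha>(1) nn[of a] nn[of b] nn[of c] nn[of d] by auto
      ultimately show ?thesis using nn' B[of "2*pi*t"] by linarith
    next
      case False
      hence "\<epsilon> * \<epsilon> * \<epsilon> * \<epsilon> \<le> ?s a * ?s b * ?s c * ?s d"
        using e by (intro mult_mono) auto
      hence "\<epsilon> ^ 4 \<le> ?s a * ?s b * ?s c * ?s d" by (simp add: power4_eq_xxxx)
      hence "\<bar>f (2 * pi * t)\<bar> * \<epsilon> ^ 4 \<le> ?fT t"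
        unfolding abs_mult by (intro mult_left_mono) auto
      hence "\<bar>f (2 * pi * t)\<bar> \<le> X" using e by (simp add: field_simps X_def)
      thus ?thesis using nn[of a] nn[of b] nn[of c] nn[of d] by linarith
    qed
    thus ?thesis unfolding sumQ X_def .
  qed
  have "((\<lambda>t. ?fT t * (1 / \<epsilon>^4) + 4 * \<epsilon> * B * (P a t + P b t + P c t + P d t)) has_integral
      integral {0..1} ?fT * (1 / \<epsilon>^4) + 4 * \<epsilon> * B * (1 + 1 + 1 + 1)) {0..1}"
    by (intro has_integral_add has_integral_mult_left has_integral_mult_right P integrable_integral iT)
  moreover have "((\<lambda>t. \<bar>f (2 * pi * t)\<bar>) has_integral integral {0..1} (\<lambda>t. \<bar>f (2 * pi * t)\<bar>)) {0..1}"
    by (intro integrable_integral integrable_continuous_interval continuous_intros cf)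
  ultimately have "integral {0..1} (\<lambda>t. \<bar>f (2 * pi * t)\<bar>) \<le>
      integral {0..1} ?fT * (1 / \<epsilon>^4) + 4 * \<epsilon> * B * (1 + 1 + 1 + 1)"
    by (intro has_integral_le[rotated 2, OF pw]) auto
  moreover have "4 * \<epsilon> * B * (1 + 1 + 1 + 1) = A / 2" using Bp by (simp add: \<epsilon>_def)
  ultimately have "A / 2 \<le> integral {0..1} ?fT * (1 / \<epsilon>^4)" using A by linarith
  hence "A / 2 * \<epsilon> ^ 4 \<le> integral {0..1} ?fT" using e by (simp add: field_simps)
  moreover have "A / 2 * \<epsilon> ^ 4 = A ^ 5 / (2 * 32 ^ 4 * B ^ 4)"
    by (simp add: \<epsilon>_def power_divide power_mult_distrib eval_nat_numeral)
  ultimately show ?thesis by simp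
qed

section \<open>Half-angle sines as trigonometric polynomials\<close>

text \<open>The sine product equals \<open>(cos (\<theta> - \<mu>) - cos \<nu>) / 2\<close>, of
  frequencies -1, 0 and 1. The factor \<open>cis \<theta>\<close> removes the negative frequency and
  leaves a polynomial in \<open>cis \<theta>\<close> whose constant term has modulus 1/4.\<close>

lemma two_sines_eq:
  fixes \<theta> a b :: real
  defines "\<mu> \<equiv> (a + b) / 2" and "\<nu> \<equiv> (b - a) / 2"
  shows "complex_of_real (sin ((\<theta> - a) / 2) * sin ((b - \<theta>) / 2)) * cis \<theta> =
    (cis (- \<mu>) * (cis \<theta>)\<^sup>2 + cis \<mu>) / 4 - complex_of_real (cos \<nu>) / 2 * cis \<theta>"
proof -
  have "sin ((\<theta> - a) / 2) * sin ((b - \<theta>) / 2) = (cos (\<theta> - \<mu>) - cos \<nu>) / 2"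
  proof -
    have "(\<theta> - a) / 2 - (b - \<theta>) / 2 = \<theta> - \<mu>" "(\<theta> - a) / 2 + (b - \<theta>) / 2 = \<nu>"
      by (auto simp: \<mu>_def \<nu>_def field_simps)
    thus ?thesis by (simp only: sin_times_sin)
  qed
  moreover have "complex_of_real (cos (\<theta> - \<mu>)) = (cis (\<theta> - \<mu>) + cis (-(\<theta> - \<mu>))) / 2"
    by (simp add: complex_eq_iff cos_diff sin_diff)
  ultimately have "complex_of_real (sin ((\<theta> - a) / 2) * sin ((b - \<theta>) / 2)) =
     ((cis (\<theta> - \<mu>) + cis (-(\<theta> - \<mu>))) / 2 - complex_of_real (cos \<nu>)) / 2"
    by (simp only: of_real_diff of_real_divide of_real_numeral)
  hence "complex_of_real (sin ((\<theta> - a) / 2) * sin ((b - \<theta>) / 2)) * cis \<theta> =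
     (cis (\<theta> - \<mu>) * cis \<theta> + cis (-(\<theta> - \<mu>)) * cis \<theta>) / 4 - complex_of_real (cos \<nu>) / 2 * cis \<theta>"
    by (simp only:) (simp add: algebra_simps diff_divide_distrib add_divide_distrib)
  moreover have "cis (\<theta> - \<mu>) * cis \<theta> = cis (- \<mu>) * (cis \<theta>)\<^sup>2"
    by (simp add: cis_mult power2_eq_square algebra_simps)
  moreover have "cis (-(\<theta> - \<mu>)) * cis \<theta> = cis \<mu>" by (simp add: cis_mult)
  ultimately show ?thesis by simp
qed

text \<open>Each pair of sines absorbs one of the two factors \<open>cis\<close>, so the integrand
  is the real part of \<open>G\<close> times two polynomials. The mean is the value at 0, where each
  polynomial contributes modulus 1/4.\<close>

lemma circle_mean_four_sines_le:
  assumes "continuous_on (cball 0 1) G" "G holomorphic_on ball 0 1"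
  shows "\<bar>integral {0..1} (\<lambda>t. Re ((cis (2 * pi * t))\<^sup>2 * G (cis (2 * pi * t))) *
     (sin ((2 * pi * t - a) / 2) * sin ((b - 2 * pi * t) / 2) *
      (sin ((2 * pi * t - c) / 2) * sin ((d - 2 * pi * t) / 2))))\<bar> \<le> cmod (G 0) / 16"
proof -
  define P where "P = (\<lambda>a b z. (cis (- ((a + b) / 2)) * z\<^sup>2 + cis ((a + b) / 2)) / 4 - complex_of_real (cos ((b - a) / 2)) / 2 * z)"
  have P: "complex_of_real (sin ((\<theta> - a) / 2) * sin ((b - \<theta>) / 2)) * cis \<theta> = P a b (cis \<theta>)" for a b \<theta>
    unfolding P_def using two_sines_eq[of \<theta> a b] by simp
  define F where "F = (\<lambda>z. G z * P a b z * P c d z)"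
  have "((\<lambda>t. F (cis (2 * pi * t))) has_integral F 0) {0..1}"
  proof (rule circle_mean_holomorphic)
    show "continuous_on (cball 0 1) F" unfolding F_def P_def by (intro continuous_intros assms) auto
    show "F holomorphic_on ball 0 1" unfolding F_def P_def by (intro holomorphic_intros assms) auto
  qed
  hence "((\<lambda>t. Re (F (cis (2 * pi * t)))) has_integral Re (F 0)) {0..1}"
    by (rule has_integral_Re_complex)
  hence 1: "integral {0..1} (\<lambda>t. Re (F (cis (2 * pi * t)))) = Re (F 0)" by (rule integral_unique)
  have 2: "Re (F (cis \<theta>)) = Re ((cis \<theta>)\<^sup>2 * G (cis \<theta>)) *
     (sin ((\<theta> - a) / 2) * sin ((b - \<theta>) / 2) * (sin ((\<theta> - c) / 2) * sin ((d - \<theta>) / 2)))" for \<theta>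
  proof -
    have "F (cis \<theta>) = of_real (sin ((\<theta> - a) / 2) * sin ((b - \<theta>) / 2) * (sin ((\<theta> - c) / 2) * sin ((d - \<theta>) / 2))) * ((cis \<theta>)\<^sup>2 * G (cis \<theta>))"
      unfolding F_def P[symmetric] of_real_mult by (simp only: power2_eq_square mult_ac)
    also have "Re (of_real x * w) = Re w * x" for x w by simp
    finally show ?thesis .
  qed
  note 1[unfolded 2]
  moreover have "cmod (F 0) = cmod (G 0) / 16"
    unfolding F_def P_def by (simp add: norm_mult norm_divide)
  ultimately show ?thesis using abs_Re_le_cmod[of "F 0"] by (simp only:)
qed

section \<open>Convex univalent functions on circles\<close>

lemma holomorphic_factor_zero_at:
  assumes f: "f holomorphic_on S" and S: "open S" "0 \<in> S" and f0: "f 0 = 0"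
  obtains g where "g holomorphic_on S" "\<And>z. z \<in> S \<Longrightarrow> f z = z * g z" "g 0 = deriv f 0"
proof
  let ?g = "\<lambda>z. if z = 0 then deriv f 0 else (f z - f 0) / (z - 0)"
  show "?g holomorphic_on S"
    using f S by (intro pole_lemma) (auto simp: interior_open)
  show "f z = z * ?g z" if "z \<in> S" for z using f0 by auto
  show "?g 0 = deriv f 0" by simp
qed

text \<open>Division by \<open>z\<close> twice. The value \<open>g 0\<close> carries the second
  derivative, and in this form the Hessian enters the estimates.\<close>

lemma holomorphic_factor_double_zero:
  assumes f: "f holomorphic_on S" and S: "open S" "0 \<in> S" and f0: "deriv f 0 = 0"
  obtains g where "g holomorphic_on S" "\<And>z. z \<in> S \<Longrightarrow> f z = f 0 + z\<^sup>2 * g z"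
    "deriv (deriv f) 0 = 2 * g 0"
proof -
  have h: "(\<lambda>z. f z - f 0) holomorphic_on S" by (intro holomorphic_intros f)
  have df: "f field_differentiable at 0" using f S by (metis holomorphic_on_imp_differentiable_at)
  have "deriv (\<lambda>z. f z - f 0) 0 = 0" using f0 df by simp
  then obtain g1 where g1: "g1 holomorphic_on S" "\<And>z. z \<in> S \<Longrightarrow> f z - f 0 = z * g1 z" "g1 0 = 0"
    using holomorphic_factor_zero_at[OF h S] by auto
  obtain g where g: "g holomorphic_on S" "\<And>z. z \<in> S \<Longrightarrow> g1 z = z * g z"
    using holomorphic_factor_zero_at[OF g1(1) S g1(3)] by metis
  have eq: "f z = f 0 + z\<^sup>2 * g z" if "z \<in> S" for z
    using g1(2)[OF that] g(2)[OF that] by (simp add: power2_eq_square algebra_simps)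
  have dg: "(g has_field_derivative deriv g z) (at z)" if "z \<in> S" for z
    using g(1) S(1) that by (rule holomorphic_derivI)
  have ddg: "(deriv g has_field_derivative deriv (deriv g) z) (at z)" if "z \<in> S" for z
    using holomorphic_deriv[OF g(1) S(1)] S(1) that by (rule holomorphic_derivI)
  have d1: "deriv f z = 2 * z * g z + z\<^sup>2 * deriv g z" if "z \<in> S" for z
  proof (rule DERIV_imp_deriv)
    have "((\<lambda>z. f 0 + z\<^sup>2 * g z) has_field_derivative 2 * z * g z + z\<^sup>2 * deriv g z) (at z)"
      by (rule derivative_eq_intros dg that refl | simp)+
    thus "(f has_field_derivative 2 * z * g z + z\<^sup>2 * deriv g z) (at z)"
      using S(1) that by (rule has_field_derivative_transform_within_open) (simp add: eq[symmetric])
  qed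
  have "deriv (deriv f) 0 = 2 * g 0"
  proof (rule DERIV_imp_deriv)
    have "((\<lambda>z. 2 * z * g z + z\<^sup>2 * deriv g z) has_field_derivative 2 * g 0) (at 0)"
      by (rule derivative_eq_intros dg ddg S refl | simp)+
    thus "(deriv f has_field_derivative 2 * g 0) (at 0)"
      using S by (rule has_field_derivative_transform_within_open) (simp add: d1)
  qed
  with g(1) eq show ?thesis using that by blast
qed

lemma Re_nonpos_at_0_if_on_right:
  fixes g :: "complex \<Rightarrow> complex"
  assumes "isCont g 0" "0 < r" and le: "\<And>t. 0 < t \<Longrightarrow> t < r \<Longrightarrow> Re (g (of_real t)) \<le> 0"
  shows "Re (g 0) \<le> 0"
proof -
  have ev: "eventually (\<lambda>t. Re (g (of_real t)) \<le> 0) (at_right 0)"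
    using eventually_at_right_real[OF \<open>0 < r\<close>] by (rule eventually_mono) (auto intro: le)
  have "isCont (\<lambda>t. g (complex_of_real t)) 0"
    using isCont_o2[of 0 complex_of_real g] \<open>isCont g 0\<close> by simp
  hence "isCont (\<lambda>t. Re (g (complex_of_real t))) 0" by (rule isCont_Re)
  hence "((\<lambda>t. Re (g (complex_of_real t))) \<longlongrightarrow> Re (g 0)) (at_right 0)"
    unfolding isCont_def by (auto intro: filterlim_mono[OF _ order_refl at_le])
  thus ?thesis using ev by (rule tendsto_upperbound) simp
qed

text \<open>For real \<open>t > 0\<close> the increment of \<open>f\<close> is
  \<open>t\<^sup>2 * g t\<close>, so maximality gives \<open>Re (g t) \<le> 0\<close>; the limit at
  0 is half the second derivative.\<close>

lemma Re_second_deriv_nonpos_at_real_max: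
  assumes f: "f holomorphic_on ball 0 r" and r: "r > 0" and f0: "deriv f 0 = 0"
    and max: "\<And>t::real. \<bar>t\<bar> < r \<Longrightarrow> Re (f (of_real t)) \<le> Re (f 0)"
  shows "Re (deriv (deriv f) 0) \<le> 0"
proof -
  obtain g where g: "g holomorphic_on ball 0 r" "\<And>z. z \<in> ball 0 r \<Longrightarrow> f z = f 0 + z\<^sup>2 * g z"
    "deriv (deriv f) 0 = 2 * g 0"
    using holomorphic_factor_double_zero[OF f _ _ f0] r by auto
  have nonpos: "Re (g (of_real t)) \<le> 0" if "0 < t" "t < r" for t :: real
  proof -
    have "Re (f (of_real t)) = Re (f 0) + t\<^sup>2 * Re (g (of_real t))"
      using g(2)[of "of_real t"] that by (simp flip: of_real_power)
    with max[of t] that have "t\<^sup>2 * Re (g (of_real t)) \<le> 0" by simp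
    with that show ?thesis by (simp add: mult_le_0_iff)
  qed
  have "isCont g 0"
    using g(1) r by (metis centre_in_ball continuous_on_eq_continuous_at holomorphic_on_imp_continuous_on open_ball)
  hence "Re (g 0) \<le> 0" using r nonpos by (rule Re_nonpos_at_0_if_on_right)
  thus ?thesis using g(3) by simp
qed

text \<open>The average of \<open>\<psi> (z exp (\<i> \<epsilon>))\<close> and \<open>\<psi> (z exp (- \<i> \<epsilon>))\<close> lies in the convex image of \<open>\<psi>\<close>, so by the
  Schwarz lemma its pullback by \<open>\<psi>\<close> is maximal in modulus at \<open>\<epsilon> = 0\<close>; the claim is the second-order condition there.\<close>
lemma convex_univalent_Re_ge_0:
  assumes \<psi>: "\<psi> holomorphic_on ball 0 1" and \<phi>: "\<phi> holomorphic_on S" and S: "open S" "convex S"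
    and \<psi>S: "\<And>z. z \<in> ball 0 1 \<Longrightarrow> \<psi> z \<in> S \<and> \<phi> (\<psi> z) = z"
    and \<phi>D: "\<And>w. w \<in> S \<Longrightarrow> \<phi> w \<in> ball 0 1"
    and \<zeta>: "\<zeta> \<in> ball 0 1"
  shows "deriv \<psi> \<zeta> \<noteq> 0" "0 \<le> Re (1 + \<zeta> * deriv (deriv \<psi>) \<zeta> / deriv \<psi> \<zeta>)"
proof -
  have d\<psi>: "(\<psi> has_field_derivative deriv \<psi> z) (at z)" if "z \<in> ball 0 1" for z
    using \<psi> open_ball that by (rule holomorphic_derivI)
  have dd\<psi>: "(deriv \<psi> has_field_derivative deriv (deriv \<psi>) z) (at z)" if "z \<in> ball 0 1" for z
    using holomorphic_deriv[OF \<psi> open_ball] open_ball that by (rule holomorphic_derivI)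
  have d\<phi>: "(\<phi> has_field_derivative deriv \<phi> z) (at z)" if "z \<in> S" for z
    using \<phi> S(1) that by (rule holomorphic_derivI)
  have dd\<phi>: "(deriv \<phi> has_field_derivative deriv (deriv \<phi>) z) (at z)" if "z \<in> S" for z
    using holomorphic_deriv[OF \<phi> S(1)] S(1) that by (rule holomorphic_derivI)
  have "((\<lambda>z. \<phi> (\<psi> z)) has_field_derivative deriv \<phi> (\<psi> \<zeta>) * deriv \<psi> \<zeta>) (at \<zeta>)"
    using \<psi>S[OF \<zeta>] \<zeta> by (intro DERIV_chain2[OF d\<phi> d\<psi>]) auto
  moreover have "((\<lambda>z. \<phi> (\<psi> z)) has_field_derivative 1) (at \<zeta>)"
    by (rule has_field_derivative_transform_within_open[OF DERIV_ident open_ball \<zeta>]) (simp add: \<psi>S)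
  ultimately have inv: "deriv \<phi> (\<psi> \<zeta>) * deriv \<psi> \<zeta> = 1" by (rule DERIV_unique)
  thus nz: "deriv \<psi> \<zeta> \<noteq> 0" by auto
  show "0 \<le> Re (1 + \<zeta> * deriv (deriv \<psi>) \<zeta> / deriv \<psi> \<zeta>)"
  proof (cases "\<zeta> = 0")
    case False
    \<comment> \<open>\<open>\<epsilon>\<close> is a complex variable, so that the midpoint and its
      pullback are holomorphic and can be differentiated twice; the comparison with
      \<open>\<epsilon> = 0\<close> is made for real values only.\<close>
    define E where "E = (\<lambda>\<epsilon>. (\<psi> (\<zeta> * exp (\<i> * \<epsilon>)) + \<psi> (\<zeta> * exp (- \<i> * \<epsilon>))) / 2)"
    define E' where "E' = (\<lambda>\<epsilon>. (deriv \<psi> (\<zeta> * exp (\<i> * \<epsilon>)) * (\<i> * \<zeta> * exp (\<i> * \<epsilon>))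
        - deriv \<psi> (\<zeta> * exp (- \<i> * \<epsilon>)) * (\<i> * \<zeta> * exp (- \<i> * \<epsilon>))) / 2)"
    define U where "U = {\<epsilon>. \<zeta> * exp (\<i> * \<epsilon>) \<in> ball 0 1} \<inter> {\<epsilon>. \<zeta> * exp (- \<i> * \<epsilon>) \<in> ball 0 1}"
    have oU: "open U" unfolding U_def
      by (intro open_Int open_vimage[unfolded vimage_def] open_ball continuous_intros)
    have dE: "(E has_field_derivative E' \<epsilon>) (at \<epsilon>)" if "\<epsilon> \<in> U" for \<epsilon>
      unfolding E_def E'_def using that unfolding U_def
      by (auto intro!: derivative_eq_intros DERIV_chain2[OF d\<psi>])
    have "E 0 = \<psi> \<zeta>" by (simp add: E_def)
    have E'0: "E' 0 = 0" by (simp add: E'_def)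
    have dE': "(E' has_field_derivative - (\<zeta> * (deriv \<psi> \<zeta> + \<zeta> * deriv (deriv \<psi>) \<zeta>))) (at 0)"
      unfolding E'_def using \<zeta>
      by (auto intro!: derivative_eq_intros DERIV_chain2[OF dd\<psi>] simp: field_simps)
    have cE: "continuous_on U E"
      by (meson DERIV_isCont continuous_at_imp_continuous_on dE)
    define V where "V = U \<inter> E -` S"
    have oV: "open V" unfolding V_def by (rule continuous_open_preimage[OF cE oU S(1)])
    have "0 \<in> V" using \<zeta> \<psi>S[OF \<zeta>] \<open>E 0 = \<psi> \<zeta>\<close> by (auto simp: V_def U_def)
    then obtain r where r: "r > 0" "ball 0 r \<subseteq> V" using oV open_contains_ball by blast
    \<comment> \<open>Dividing by \<open>\<zeta>\<close> normalises \<open>f 0 = 1\<close>, so a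
      bound 1 on the modulus already says that the real part is maximal at 0.\<close>
    define f where "f = (\<lambda>\<epsilon>. \<phi> (E \<epsilon>) / \<zeta>)"
    have df: "(f has_field_derivative deriv \<phi> (E \<epsilon>) * E' \<epsilon> / \<zeta>) (at \<epsilon>)" if "\<epsilon> \<in> V" for \<epsilon>
      unfolding f_def using that False unfolding V_def
      by (auto intro!: derivative_eq_intros DERIV_chain2[OF d\<phi>] dE)
    have hf: "f holomorphic_on ball 0 r"
      using df r(2) by (meson holomorphic_on_open open_ball subset_iff)
    have df0: "deriv f 0 = 0" using DERIV_imp_deriv[OF df[OF \<open>0 \<in> V\<close>]] E'0 by simp
    have "Re (deriv (deriv f) 0) \<le> 0"
    proof (rule Re_second_deriv_nonpos_at_real_max[OF hf r(1) df0])
      fix t :: real assume t: "\<bar>t\<bar> < r"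
      have ce: "exp (\<i> * of_real t) = cis t" "exp (- \<i> * of_real t) = cis (-t)"
        by (simp_all add: cis_conv_exp)
      \<comment> \<open>With \<open>t\<close> fixed, the midpoint is formed at every
        \<open>z\<close> of the disc. The result is a holomorphic self-map of the disc fixing 0, to
        which the Schwarz lemma applies.\<close>
      define q where "q = (\<lambda>z. \<phi> ((1/2) *\<^sub>R \<psi> (z * cis t) + (1/2) *\<^sub>R \<psi> (z * cis (- t))))"
      have mid: "(1/2) *\<^sub>R \<psi> (z * cis t) + (1/2) *\<^sub>R \<psi> (z * cis (- t)) \<in> S" if "cmod z < 1" for z
        by (intro convexD[OF S(2)]) (use that \<psi>S in \<open>auto simp: norm_mult\<close>)
      have "cmod (q \<zeta>) \<le> cmod \<zeta>"
      proof (rule Schwarz_Lemma(1))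
        have "(\<lambda>z. \<psi> (z * cis a)) holomorphic_on ball 0 1" for a
          by (intro holomorphic_on_compose_gen[OF _ \<psi>, unfolded o_def] holomorphic_intros) (auto simp: norm_mult)
        thus "q holomorphic_on ball 0 1" unfolding q_def scaleR_conv_of_real
          by (intro holomorphic_on_compose_gen[OF _ \<phi>, unfolded o_def] holomorphic_intros)
             (use mid in \<open>auto simp: scaleR_conv_of_real\<close>)
        show "q 0 = 0" unfolding q_def using \<psi>S[of 0] by (simp flip: scaleR_add_left)
        show "cmod (q z) < 1" if "cmod z < 1" for z
          unfolding q_def using \<phi>D[OF mid[OF that]] by simp
        show "cmod \<zeta> < 1" using \<zeta> by simp
      qed
      moreover have "f (of_real t) = q \<zeta> / \<zeta>"
        unfolding f_def q_def E_def ce by (simp add: scaleR_conv_of_real add_divide_distrib)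
      ultimately have "cmod (f (of_real t)) \<le> 1" using False by (simp add: norm_divide)
      moreover have "f 0 = 1" unfolding f_def \<open>E 0 = \<psi> \<zeta>\<close> using \<psi>S[OF \<zeta>] False by simp
      ultimately show "Re (f (of_real t)) \<le> Re (f 0)"
        using complex_Re_le_cmod[of "f (of_real t)"] by simp
    qed
    moreover have "deriv (deriv f) 0 = - (1 + \<zeta> * deriv (deriv \<psi>) \<zeta> / deriv \<psi> \<zeta>)"
    proof (rule DERIV_imp_deriv)
      have "((\<lambda>\<epsilon>. deriv \<phi> (E \<epsilon>) * E' \<epsilon> / \<zeta>) has_field_derivative
          deriv \<phi> (E 0) * (- (\<zeta> * (deriv \<psi> \<zeta> + \<zeta> * deriv (deriv \<psi>) \<zeta>))) / \<zeta>) (at 0)"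
        using \<open>0 \<in> V\<close> False unfolding V_def
        by (auto intro!: derivative_eq_intros DERIV_chain2[OF dd\<phi>] dE dE' simp: E'0)
      moreover have "deriv \<phi> (E 0) * (- (\<zeta> * (deriv \<psi> \<zeta> + \<zeta> * deriv (deriv \<psi>) \<zeta>))) / \<zeta>
          = - (1 + \<zeta> * deriv (deriv \<psi>) \<zeta> / deriv \<psi> \<zeta>)"
      proof -
        have "deriv \<phi> (E 0) = 1 / deriv \<psi> \<zeta>" using inv nz \<open>E 0 = \<psi> \<zeta>\<close> by (simp add: field_simps)
        thus ?thesis using False nz by (simp add: field_simps)
      qed
      ultimately have "((\<lambda>\<epsilon>. deriv \<phi> (E \<epsilon>) * E' \<epsilon> / \<zeta>) has_field_derivative
         - (1 + \<zeta> * deriv (deriv \<psi>) \<zeta> / deriv \<psi> \<zeta>)) (at 0)" by metis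
      thus "(deriv f has_field_derivative - (1 + \<zeta> * deriv (deriv \<psi>) \<zeta> / deriv \<psi> \<zeta>)) (at 0)"
        by (rule has_field_derivative_transform_within_open[OF _ oV \<open>0 \<in> V\<close>])
           (metis DERIV_imp_deriv df)
    qed
    ultimately show ?thesis by simp
  qed simp
qed

section \<open>Signs of a periodic function relative to a level\<close>

text \<open>Over the period starting at \<open>a\<close>, the sine product is positive between
  \<open>a\<close> and \<open>b\<close>, negative between \<open>b\<close> and
  \<open>a + 2 * pi\<close>, and zero at these three points, which matches the sign of
  \<open>Y - t\<close>. Every other angle is moved into this period.\<close>

lemma periodic_sign_pattern:
  fixes Y :: "real \<Rightarrow> real"
  assumes per: "\<And>\<theta>. Y (\<theta> + 2 * pi) = Y \<theta>" and ab: "a \<le> b" "b \<le> a + 2 * pi"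
    and ge: "\<And>\<theta>. a < \<theta> \<Longrightarrow> \<theta> < b \<Longrightarrow> t \<le> Y \<theta>"
    and le: "\<And>\<theta>. b < \<theta> \<Longrightarrow> \<theta> < a + 2 * pi \<Longrightarrow> Y \<theta> \<le> t"
  shows "0 \<le> (Y \<theta> - t) * (sin ((\<theta> - a) / 2) * sin ((b - \<theta>) / 2))"
proof -
  define Q where "Q = (\<lambda>\<theta>. (Y \<theta> - t) * (sin ((\<theta> - a) / 2) * sin ((b - \<theta>) / 2)))"
  \<comment> \<open>A shift by \<open>2 * pi\<close> reverses the sign of each single sine, so only
    their product is periodic.\<close>
  have "Q (\<theta> + 2 * pi) = Q \<theta>" for \<theta>
  proof -
    have "(\<theta> + 2 * pi - a) / 2 = (\<theta> - a) / 2 + pi" "(b - (\<theta> + 2 * pi)) / 2 = (b - \<theta>) / 2 - pi"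
      by (simp_all add: field_simps)
    thus ?thesis unfolding Q_def per by (simp only: sin_periodic_pi sin_diff cos_pi sin_pi) simp
  qed
  then interpret periodic_fun_simple Q "2 * pi" by unfold_locales
  define n where "n = \<lfloor>(\<theta> - a) / (2 * pi)\<rfloor>"
  define \<theta>' where "\<theta>' = \<theta> - of_int n * (2 * pi)"
  have "of_int n \<le> (\<theta> - a) / (2 * pi)" "(\<theta> - a) / (2 * pi) < of_int n + 1"
    unfolding n_def by linarith+
  hence th: "a \<le> \<theta>'" "\<theta>' \<le> a + 2 * pi"
    unfolding \<theta>'_def by (simp_all add: field_simps)
  have "0 \<le> Q \<theta>'"
  proof -
    consider "\<theta>' = a \<or> \<theta>' = b \<or> \<theta>' = a + 2 * pi" | "a < \<theta>'" "\<theta>' < b" | "b < \<theta>'" "\<theta>' < a + 2 * pi"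
      using th by linarith
    thus ?thesis
    proof cases
      case 1
      thus ?thesis by (auto simp: Q_def)
    next
      case 2
      hence "0 \<le> sin ((\<theta>' - a) / 2)" "0 \<le> sin ((b - \<theta>') / 2)"
        using th ab by (auto intro!: sin_ge_zero)
      thus ?thesis using ge[OF 2] by (simp add: Q_def)
    next
      case 3
      hence "0 \<le> sin ((\<theta>' - a) / 2)" "0 \<le> sin ((\<theta>' - b) / 2)"
        using th ab by (auto intro!: sin_ge_zero)
      moreover have "sin ((b - \<theta>') / 2) = - sin ((\<theta>' - b) / 2)"
        by (metis minus_diff_eq minus_divide_left sin_minus)
      ultimately have "sin ((\<theta>' - a) / 2) * sin ((b - \<theta>') / 2) \<le> 0"
        by (simp add: mult_nonneg_nonpos)
      moreover have "Y \<theta>' - t \<le> 0" using le[OF 3] by simp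
      ultimately show ?thesis unfolding Q_def by (intro mult_nonpos_nonpos)
    qed
  qed
  also have "Q \<theta>' = Q \<theta>" unfolding \<theta>'_def by (rule minus_of_int)
  finally show ?thesis unfolding Q_def .
qed

text \<open>\<open>\<Phi>\<close> plays the role of the tangent angle of a convex curve, and \<open>Y\<close> that of its height.\<close>
lemma unimodal_level_sign_pattern:
  fixes Y \<Phi> r :: "real \<Rightarrow> real"
  assumes per: "\<And>\<theta>. Y (\<theta> + 2 * pi) = Y \<theta>"
    and der: "\<And>\<theta>. (Y has_real_derivative r \<theta> * cos (\<Phi> \<theta>)) (at \<theta>)" and r: "\<And>\<theta>. 0 \<le> r \<theta>"
    and cont: "\<And>S. continuous_on S \<Phi>" and mono: "mono \<Phi>"
    and shift: "\<And>\<theta>. \<Phi> (\<theta> + 2 * pi) = \<Phi> \<theta> + 2 * pi"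
  obtains a b where "\<And>\<theta>. 0 \<le> (Y \<theta> - t) * (sin ((\<theta> - a) / 2) * sin ((b - \<theta>) / 2))"
proof -
  interpret D: periodic_fun_simple "\<lambda>\<theta>. \<Phi> \<theta> - \<theta>" "2 * pi"
    by unfold_locales (simp add: shift)
  \<comment> \<open>This \<open>n\<close> places \<open>- pi / 2\<close> between the values of
    \<open>\<Phi>\<close> at the multiples \<open>n\<close> and \<open>n + 1\<close> of
    \<open>2 * pi\<close>. From the resulting \<open>a0\<close>, \<open>Y\<close> rises until
    \<open>\<Phi>\<close> reaches \<open>pi / 2\<close> at \<open>a1\<close> and falls until
    \<open>a0 + 2 * pi\<close>.\<close>
  define n where "n = \<lfloor>(- pi / 2 - \<Phi> 0) / (2 * pi)\<rfloor>"
  have n: "\<Phi> (of_int m * (2 * pi)) = \<Phi> 0 + of_int m * (2 * pi)" for m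
    using D.plus_of_int[of 0 m] by simp
  have "of_int n \<le> (- pi / 2 - \<Phi> 0) / (2 * pi)" "(- pi / 2 - \<Phi> 0) / (2 * pi) < of_int n + 1"
    unfolding n_def by linarith+
  hence "\<Phi> (of_int n * (2 * pi)) \<le> - (pi / 2)" "- (pi / 2) \<le> \<Phi> (of_int (n + 1) * (2 * pi))"
    unfolding n by (simp_all add: field_simps)
  then obtain a0 where a0: "\<Phi> a0 = - (pi / 2)"
    using IVT'[of \<Phi> "of_int n * (2 * pi)" "- (pi/2)" "of_int (n + 1) * (2 * pi)"] cont
    by (auto simp: algebra_simps)
  have a0': "\<Phi> (a0 + 2 * pi) = 3 * pi / 2" using shift[of a0] a0 by simp
  then obtain a1 where a1: "a0 \<le> a1" "a1 \<le> a0 + 2 * pi" "\<Phi> a1 = pi / 2"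
    using IVT'[of \<Phi> a0 "pi/2" "a0 + 2 * pi"] a0 cont by auto
  have up: "Y x \<le> Y y" if "a0 \<le> x" "x \<le> y" "y \<le> a1" for x y
  proof (rule DERIV_nonneg_imp_nondecreasing[OF that(2)])
    fix z assume "x \<le> z" "z \<le> y"
    hence "\<Phi> a0 \<le> \<Phi> z" "\<Phi> z \<le> \<Phi> a1" using that by (auto intro!: monoD[OF mono])
    hence "0 \<le> cos (\<Phi> z)" using a0 a1 by (intro cos_ge_zero) auto
    thus "\<exists>y. (Y has_real_derivative y) (at z) \<and> 0 \<le> y" using der r by (meson mult_nonneg_nonneg)
  qed
  have dn: "Y y \<le> Y x" if "a1 \<le> x" "x \<le> y" "y \<le> a0 + 2 * pi" for x y
  proof (rule DERIV_nonpos_imp_nonincreasing[OF that(2)])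
    fix z assume "x \<le> z" "z \<le> y"
    hence "\<Phi> a1 \<le> \<Phi> z" "\<Phi> z \<le> \<Phi> (a0 + 2 * pi)" using that by (auto intro!: monoD[OF mono])
    hence "0 \<le> cos (\<Phi> z - pi)" using a0' a1 by (intro cos_ge_zero) auto
    hence "cos (\<Phi> z) \<le> 0" by simp
    thus "\<exists>y. (Y has_real_derivative y) (at z) \<and> y \<le> 0" using der r by (meson mult_nonneg_nonpos)
  qed
  have per': "Y (x - 2 * pi) = Y x" for x using per[of "x - 2 * pi"] by simp
  have Y0: "Y (a0 + 2 * pi) = Y a0" by (rule per)
  \<comment> \<open>Above the maximum \<open>Y a1\<close> the pattern degenerates to
    \<open>a = b = a1\<close>, below the minimum \<open>Y a0\<close> to \<open>a = a0\<close> and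
    \<open>b = a0 + 2 * pi\<close>. In between, \<open>a\<close> is a crossing on the rising arc and
    \<open>b\<close> one on the falling arc.\<close>
  consider "Y a1 \<le> t" | "t \<le> Y a0" | "Y a0 \<le> t" "t \<le> Y a1" by linarith
  thus ?thesis
  proof cases
    case 1
    show ?thesis
    proof (rule that, rule periodic_sign_pattern[where Y = Y, OF per])
      show "Y \<theta> \<le> t" if "a1 < \<theta>" "\<theta> < a1 + 2 * pi" for \<theta>
        using dn[of a1 \<theta>] up[of "\<theta> - 2 * pi" a1] per'[of \<theta>] that a1 1 by linarith
    qed auto
  next
    case 2
    show ?thesis
    proof (rule that, rule periodic_sign_pattern[where Y = Y, OF per])
      show "t \<le> Y \<theta>" if "a0 < \<theta>" "\<theta> < a0 + 2 * pi" for \<theta>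
        using dn[of \<theta> "a0 + 2 * pi"] up[of a0 \<theta>] that a1 2 Y0 by linarith
    qed auto
  next
    case 3
    have cY: "continuous_on S Y" for S
      by (meson DERIV_isCont continuous_at_imp_continuous_on der)
    obtain a where a: "a0 \<le> a" "a \<le> a1" "Y a = t"
      using IVT'[of Y a0 t a1] 3 a1 cY by auto
    obtain b where b: "a1 \<le> b" "b \<le> a0 + 2 * pi" "Y b = t"
      using IVT2'[of Y "a0 + 2 * pi" t a1] 3 a1 cY Y0 by auto
    show ?thesis
    proof (rule that, rule periodic_sign_pattern[where Y = Y, OF per])
      show "a \<le> b" "b \<le> a + 2 * pi" using a b by auto
      show "t \<le> Y \<theta>" if "a < \<theta>" "\<theta> < b" for \<theta>
        using up[of a \<theta>] dn[of \<theta> b] a b that by linarith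
      show "Y \<theta> \<le> t" if "b < \<theta>" "\<theta> < a + 2 * pi" for \<theta>
        using dn[of b \<theta>] up[of "\<theta> - 2 * pi" a] per'[of \<theta>] a b that by linarith
    qed
  qed
qed

text \<open>The image of the circle has tangent vector
  \<open>\<i> * \<zeta> * deriv \<psi> \<zeta>\<close>. Writing \<open>deriv \<psi> = exp k\<close>,
  its angle measured from the upward vertical is \<open>\<theta> + Im (k \<zeta>)\<close>, and the
  derivative of this angle is the quantity shown nonnegative in
  \<open>convex_univalent_Re_ge_0\<close>. Hence the height is unimodal along the circle.\<close>

lemma convex_univalent_circle_sign_pattern:
  assumes \<psi>: "\<psi> holomorphic_on ball 0 1" and \<phi>: "\<phi> holomorphic_on S" and S: "open S" "convex S"
    and \<psi>S: "\<And>z. z \<in> ball 0 1 \<Longrightarrow> \<psi> z \<in> S \<and> \<phi> (\<psi> z) = z"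
    and \<phi>D: "\<And>w. w \<in> S \<Longrightarrow> \<phi> w \<in> ball 0 1"
    and s: "0 < s" "s < 1"
  obtains a b where
    "\<And>\<theta>. 0 \<le> (Im (\<psi> (of_real s * cis \<theta>)) - t) * (sin ((\<theta> - a) / 2) * sin ((b - \<theta>) / 2))"
proof -
  note conv = convex_univalent_Re_ge_0[OF \<psi> \<phi> S \<psi>S \<phi>D]
  have h\<psi>': "deriv \<psi> holomorphic_on ball 0 1" by (rule holomorphic_deriv[OF \<psi> open_ball])
  \<comment> \<open>The zero-free derivative has a holomorphic logarithm on the disc. Its imaginary
    part is a single-valued argument, so the tangent angle gains exactly \<open>2 * pi\<close> per
    turn.\<close>
  obtain k where k: "k holomorphic_on ball 0 1" "\<And>z. z \<in> ball 0 1 \<Longrightarrow> deriv \<psi> z = exp (k z)"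
    using contractible_imp_holomorphic_log[OF h\<psi>' convex_imp_contractible[OF convex_ball]] conv(1) by blast
  have d\<psi>: "(\<psi> has_field_derivative exp (k z)) (at z)" if "z \<in> ball 0 1" for z
    using holomorphic_derivI[OF \<psi> open_ball that] k(2)[OF that] by simp
  have dk: "(k has_field_derivative deriv k z) (at z)" if "z \<in> ball 0 1" for z
    using holomorphic_derivI[OF k(1) open_ball that] .
  have dd: "deriv (deriv \<psi>) z = deriv k z * exp (k z)" if "z \<in> ball 0 1" for z
  proof (rule DERIV_imp_deriv)
    have "((\<lambda>z. exp (k z)) has_field_derivative deriv k z * exp (k z)) (at z)"
      by (rule derivative_eq_intros dk that refl | simp)+
    thus "(deriv \<psi> has_field_derivative deriv k z * exp (k z)) (at z)"
      using open_ball that by (rule has_field_derivative_transform_within_open) (simp add: k(2))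
  qed
  have pos: "0 \<le> Re (1 + z * deriv k z)" if "z \<in> ball 0 1" for z
    using conv(2)[OF _ _ that] dd[OF that] k(2)[OF that] by simp
  define \<zeta> where "\<zeta> = (\<lambda>\<theta>. of_real s * cis \<theta>)"
  have \<zeta>: "\<zeta> \<theta> \<in> ball 0 1" for \<theta> using s by (simp add: \<zeta>_def norm_mult)
  have d\<zeta>: "(\<zeta> has_vector_derivative \<i> * \<zeta> \<theta>) (at \<theta>)" for \<theta>
    unfolding \<zeta>_def cis_conv_exp
    by (rule derivative_eq_intros has_vector_derivative_real_field refl | simp)+
  have dv: "((\<lambda>\<theta>. Im (F (\<zeta> \<theta>))) has_real_derivative Im (\<i> * \<zeta> \<theta> * F')) (at \<theta>)"
    if "(F has_field_derivative F') (at (\<zeta> \<theta>))" for F F' \<theta>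
  proof -
    have "((F \<circ> \<zeta>) has_vector_derivative \<i> * \<zeta> \<theta> * F') (at \<theta>)"
      by (rule field_vector_diff_chain_at[OF d\<zeta> that])
    hence "((\<lambda>\<theta>. Im ((F \<circ> \<zeta>) \<theta>)) has_vector_derivative Im (\<i> * \<zeta> \<theta> * F')) (at \<theta>)"
      by (rule bounded_linear.has_vector_derivative[OF bounded_linear_Im])
    thus ?thesis by (simp add: has_real_derivative_iff_has_vector_derivative)
  qed
  define \<Phi> where "\<Phi> = (\<lambda>\<theta>. \<theta> + Im (k (\<zeta> \<theta>)))"
  have per: "\<zeta> (\<theta> + 2 * pi) = \<zeta> \<theta>" for \<theta> by (simp add: \<zeta>_def cis_mult[symmetric])
  have d\<Phi>: "(\<Phi> has_real_derivative Re (1 + \<zeta> \<theta> * deriv k (\<zeta> \<theta>))) (at \<theta>)" for \<theta>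
    unfolding \<Phi>_def by (rule derivative_eq_intros dv[OF dk[OF \<zeta>]] refl | simp)+
  obtain a b where "\<And>\<theta>. 0 \<le> (Im (\<psi> (\<zeta> \<theta>)) - t) * (sin ((\<theta> - a) / 2) * sin ((b - \<theta>) / 2))"
  proof (rule unimodal_level_sign_pattern[where Y = "\<lambda>\<theta>. Im (\<psi> (\<zeta> \<theta>))" and \<Phi> = \<Phi> and t = t
        and r = "\<lambda>\<theta>. s * exp (Re (k (\<zeta> \<theta>)))"])
    show "Im (\<psi> (\<zeta> (\<theta> + 2 * pi))) = Im (\<psi> (\<zeta> \<theta>))" for \<theta> by (simp only: per)
    show "((\<lambda>\<theta>. Im (\<psi> (\<zeta> \<theta>))) has_real_derivative s * exp (Re (k (\<zeta> \<theta>))) * cos (\<Phi> \<theta>)) (at \<theta>)" for \<theta>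
    proof -
      have "Im (\<i> * \<zeta> \<theta> * exp (k (\<zeta> \<theta>))) = s * exp (Re (k (\<zeta> \<theta>))) * cos (\<Phi> \<theta>)"
        unfolding \<Phi>_def by (simp add: \<zeta>_def Re_exp Im_exp cos_add algebra_simps)
      thus ?thesis using dv[OF d\<psi>[OF \<zeta>], of \<theta>] by simp
    qed
    show "0 \<le> s * exp (Re (k (\<zeta> \<theta>)))" for \<theta> using s by simp
    show "continuous_on T \<Phi>" for T
      using d\<Phi> by (meson DERIV_isCont continuous_at_imp_continuous_on)
    show "mono \<Phi>"
    proof (rule monoI)
      fix x y :: real assume "x \<le> y"
      thus "\<Phi> x \<le> \<Phi> y" 
        by (rule DERIV_nonneg_imp_nondecreasing) (use d\<Phi> pos \<zeta> in blast)
    qed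
    show "\<Phi> (\<theta> + 2 * pi) = \<Phi> \<theta> + 2 * pi" for \<theta> by (simp add: \<Phi>_def per)
  qed (use that in blast)
  thus ?thesis using that unfolding \<zeta>_def by blast
qed

section \<open>Harmonic functions on convex domains\<close>

text \<open>A Riemann map followed by the disc automorphism that moves the image of
  \<open>z0\<close> to the centre.\<close>

lemma normalized_Riemann_map:
  assumes S: "open S" "simply_connected S" "S \<noteq> UNIV" "z0 \<in> S"
  obtains \<phi> \<psi> where "\<psi> holomorphic_on ball 0 1" "\<phi> holomorphic_on S" "\<psi> 0 = z0"
    "\<And>z. z \<in> ball 0 1 \<Longrightarrow> \<psi> z \<in> S \<and> \<phi> (\<psi> z) = z"
    "\<And>w. w \<in> S \<Longrightarrow> \<phi> w \<in> ball 0 1 \<and> \<psi> (\<phi> w) = w"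
proof -
  obtain f g where fg: "f holomorphic_on S" "g holomorphic_on ball 0 1"
    "\<And>z. z \<in> S \<Longrightarrow> f z \<in> ball 0 1 \<and> g (f z) = z"
    "\<And>z. z \<in> ball 0 1 \<Longrightarrow> g z \<in> S \<and> f (g z) = z"
    using simply_connected_eq_biholomorphic_to_disc[OF S(1)] S by blast
  obtain h k where hk: "h (f z0) = 0" "h holomorphic_on ball 0 1" "h ` ball 0 1 \<subseteq> ball 0 1"
    "k holomorphic_on ball 0 1" "k ` ball 0 1 \<subseteq> ball 0 1"
    "\<And>z. z \<in> ball 0 1 \<Longrightarrow> h (k z) = z" "\<And>z. z \<in> ball 0 1 \<Longrightarrow> k (h z) = z"
    by (rule ball_biholomorphism_exists[of "f z0"]) (use fg(3) S(4) in auto)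
  show ?thesis
  proof (rule that[of "g \<circ> k" "h \<circ> f"])
    show "g \<circ> k holomorphic_on ball 0 1"
      by (rule holomorphic_on_compose_gen[OF hk(4) fg(2)]) (use hk(5) in auto)
    show "h \<circ> f holomorphic_on S"
      by (rule holomorphic_on_compose_gen[OF fg(1) hk(2)]) (use fg(3) in auto)
    show "(g \<circ> k) 0 = z0" using hk(1,7) fg(3)[OF S(4)] by (metis comp_apply)
    show "(g \<circ> k) z \<in> S \<and> (h \<circ> f) ((g \<circ> k) z) = z" if "z \<in> ball 0 1" for z
      using fg(4)[of "k z"] hk(5,6) that by (auto simp: image_subset_iff)
    show "(h \<circ> f) w \<in> ball 0 1 \<and> (g \<circ> k) ((h \<circ> f) w) = w" if "w \<in> S" for w
      using fg(3)[OF that] hk(3,7) by (auto simp: image_subset_iff)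
  qed
qed

text \<open>As \<open>cmod (exp (- G)) = exp (- V)\<close>, an interior minimum of \<open>V\<close>
  is a maximum of modulus. Then \<open>V\<close> is constant on \<open>S\<close>, by continuity also
  on its closure, and so equals a boundary value; boundedness of \<open>S\<close> supplies a
  boundary point.\<close>

lemma harmonic_minimum_principle:
  fixes V :: "complex \<Rightarrow> real"
  assumes S: "open S" "connected S" "bounded S"
    and cont: "continuous_on (closure S) V" and G: "G holomorphic_on S"
    and VG: "\<And>z. z \<in> S \<Longrightarrow> V z = Re (G z)" and fr: "\<And>z. z \<in> frontier S \<Longrightarrow> 0 \<le> V z"
    and z: "z \<in> S"
  shows "0 \<le> V z"
proof -
  have "compact (closure S)" "closure S \<noteq> {}" using S(3) z closure_subset by auto
  then obtain z0 where z0: "z0 \<in> closure S" "\<And>w. w \<in> closure S \<Longrightarrow> V z0 \<le> V w"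
    using continuous_attains_inf[OF _ _ cont] by blast
  have "0 \<le> V z0"
  proof (cases "z0 \<in> S")
    case False
    thus ?thesis using fr z0(1) by (simp add: frontier_def interior_open[OF S(1)])
  next
    case True
    have "(\<lambda>w. exp (- G w)) constant_on S"
    proof (rule maximum_modulus_principle[OF _ S(1,2) S(1) order_refl True])
      show "cmod (exp (- G w)) \<le> cmod (exp (- G z0))" if "w \<in> S" for w
        using z0(2)[of w] VG[OF that] VG[OF True] closure_subset that by auto
    qed (intro holomorphic_intros G)
    then obtain c where c: "\<And>w. w \<in> S \<Longrightarrow> exp (- G w) = c" by (auto simp: constant_on_def)
    have "V w = V z0" if "w \<in> S" for w
    proof -
      have "cmod (exp (- G w)) = cmod (exp (- G z0))" using c that True by simp
      thus ?thesis using VG[OF that] VG[OF True] by simp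
    qed
    hence const: "V w = V z0" if "w \<in> closure S" for w
      using continuous_constant_on_closure[OF cont _ that] by blast
    have "frontier S \<noteq> {}" using S z by (metis empty_iff frontier_eq_empty not_bounded_UNIV)
    then obtain w where "w \<in> frontier S" by blast
    thus ?thesis using const[of w] fr[of w] by (simp add: frontier_def)
  qed
  thus ?thesis using z0(2)[of z] z closure_subset by fastforce
qed

text \<open>The set where \<open>\<bar>U\<bar> \<ge> \<delta>\<close> is compact and lies inside
  \<open>S\<close>, so \<open>\<phi>\<close> maps it into a smaller concentric disc. A circle
  outside that disc can stand in for the boundary of \<open>S\<close>.\<close>

lemma uniformly_small_near_unit_circle:
  fixes U :: "complex \<Rightarrow> real"
  assumes S: "open S" "bounded S" and cont: "continuous_on (closure S) U"
    and fr: "\<And>z. z \<in> frontier S \<Longrightarrow> U z = 0"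
    and \<phi>: "continuous_on S \<phi>" "\<And>w. w \<in> S \<Longrightarrow> \<phi> w \<in> ball (0::complex) 1"
    and \<psi>: "\<And>z. z \<in> ball 0 1 \<Longrightarrow> \<psi> z \<in> S \<and> \<phi> (\<psi> z) = z"
    and \<delta>: "0 < \<delta>"
  obtains s where "0 < s" "s < 1" "\<And>\<theta>. \<bar>U (\<psi> (of_real s * cis \<theta>))\<bar> < \<delta>"
proof -
  define K where "K = {z \<in> closure S. \<delta> \<le> \<bar>U z\<bar>}"
  have "K = closure S \<inter> (\<lambda>z. \<bar>U z\<bar>) -` {\<delta>..}" by (auto simp: K_def)
  hence "closed K"
    using continuous_closed_preimage[OF continuous_on_rabs[OF cont] closed_closure closed_atLeast] by simp
  hence cK: "compact K" using S(2) unfolding K_def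
    by (metis (lifting) mem_Collect_eq subsetI bounded_closure bounded_subset compact_eq_bounded_closed)
  have KS: "K \<subseteq> S"
    using fr \<delta> by (force simp: K_def frontier_def interior_open[OF S(1)])
  have "compact (\<phi> ` K)" using cK KS \<phi>(1) by (intro compact_continuous_image) (auto intro: continuous_on_subset)
  moreover have "\<phi> ` K \<subseteq> ball 0 1" using \<phi>(2) KS by auto
  ultimately obtain s0 where s0: "s0 < 1" "\<phi> ` K \<subseteq> cball 0 s0"
  proof (cases "K = {}")
    case True
    thus ?thesis using that[of 0] by simp
  next
    case False
    with \<open>compact (\<phi> ` K)\<close> obtain w where "w \<in> \<phi> ` K" "\<And>v. v \<in> \<phi> ` K \<Longrightarrow> norm v \<le> norm w"
      using continuous_attains_sup[of "\<phi> ` K" norm] by (auto intro: continuous_intros)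
    thus ?thesis using that[of "norm w"] \<open>\<phi> ` K \<subseteq> ball 0 1\<close> by fastforce
  qed
  \<comment> \<open>\<open>max s0 0\<close> keeps the radius positive, since \<open>s0\<close> is
    only known to be less than 1.\<close>
  define s where "s = (1 + max s0 0) / 2"
  have s: "0 < s" "s < 1" "s0 < s" using s0(1) by (auto simp: s_def max_def field_simps)
  show ?thesis
  proof (rule that[OF s(1,2)])
    fix \<theta>
    define z where "z = of_real s * cis \<theta>"
    have z: "cmod z = s" using s by (simp add: z_def norm_mult)
    hence "z \<in> ball 0 1" using s by simp
    note p = \<psi>[OF this]
    have "\<psi> z \<notin> K"
    proof
      assume "\<psi> z \<in> K"
      hence "\<phi> (\<psi> z) \<in> cball 0 s0" using s0(2) by blast
      thus False using p z s(3) by simp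
    qed
    thus "\<bar>U (\<psi> (of_real s * cis \<theta>))\<bar> < \<delta>"
      using p closure_subset[of S] by (auto simp: K_def z_def)
  qed
qed

text \<open>For \<open>k = pi / (2 * h)\<close>, the harmonic function
  \<open>Re (cosh (k * z))\<close> is 1 at the origin and vanishes on the lines
  \<open>Im z = h\<close> and \<open>Im z = -h\<close>. It is thus bounded above by a multiple of
  \<open>\<bar>(Im z)\<^sup>2 - h\<^sup>2\<bar>\<close>, and the mean value property over the circle
  turns this into a lower bound.\<close>

lemma circle_mean_quadratic_deviation_ge:
  assumes \<psi>: "continuous_on (cball 0 1) \<psi>" "\<psi> holomorphic_on ball 0 1" "\<psi> 0 = 0"
    and D: "\<And>\<theta>. cmod (\<psi> (cis \<theta>)) \<le> D" and h: "0 < h"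
  shows "h\<^sup>2 / (pi * cosh (pi * D / (2 * h))) \<le>
    integral {0..1} (\<lambda>t. \<bar>((Im (\<psi> (cis (2 * pi * t))))\<^sup>2 - h\<^sup>2) / 2\<bar>)"
proof -
  define k where "k = pi / (2 * h)"
  have k: "k > 0" using h by (simp add: k_def)
  \<comment> \<open>Collects \<open>cosh (k * Re z) \<le> cosh (k * D)\<close>,
    \<open>cos (k * Im z) \<le> k * \<bar>\<bar>Im z\<bar> - h\<bar>\<close> and
    \<open>\<bar>\<bar>Im z\<bar> - h\<bar> \<le> \<bar>(Im z)\<^sup>2 - h\<^sup>2\<bar> /
    h\<close>; the 2 undoes the halving in the integrand.\<close>
  define C where "C = 2 * k * cosh (k * D) / h"
  have C: "C > 0" using k h by (simp add: C_def)
  have pw: "Re (cosh (of_real k * z)) \<le> C * \<bar>((Im z)\<^sup>2 - h\<^sup>2) / 2\<bar>" if z: "cmod z \<le> D" for z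
  proof -
    have "Re (cosh (of_real k * z)) = cosh (k * Re z) * cos (k * Im z)"
      by (simp add: cosh_def Re_exp field_simps)
    also have "\<dots> \<le> cosh (k * D) * (k * \<bar>\<bar>Im z\<bar> - h\<bar>)"
    proof (rule order_trans[OF mult_left_mono mult_right_mono])
      have "cosh (k * Re z) = cosh \<bar>k * Re z\<bar>" by (simp add: abs_if)
      also have "\<dots> \<le> cosh (k * D)"
      proof -
        have "\<bar>k * Re z\<bar> \<le> k * D"
          using abs_Re_le_cmod[of z] z k by (auto simp: abs_mult)
        moreover have "0 \<le> k * D" using z k norm_ge_zero[of z] by (intro mult_nonneg_nonneg) linarith+
        ultimately show ?thesis by (subst cosh_real_nonneg_le_iff) auto
      qed
      finally show "cosh (k * Re z) \<le> cosh (k * D)" .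
      have "cos (k * Im z) = cos (k * \<bar>Im z\<bar>)" by (simp add: abs_if)
      also have "\<dots> = sin (pi / 2 - k * \<bar>Im z\<bar>)" by (simp add: sin_diff)
      also have "\<dots> \<le> \<bar>pi / 2 - k * \<bar>Im z\<bar>\<bar>" using abs_sin_x_le_abs_x[of "pi / 2 - k * \<bar>Im z\<bar>"] by linarith
      also have "pi / 2 - k * \<bar>Im z\<bar> = - (k * (\<bar>Im z\<bar> - h))" using h by (simp add: k_def field_simps)
      also have "\<bar>\<dots>\<bar> = k * \<bar>\<bar>Im z\<bar> - h\<bar>" using k by (simp add: abs_mult)
      finally show "cos (k * Im z) \<le> k * \<bar>\<bar>Im z\<bar> - h\<bar>" .
    qed (use k in auto)
    also have "\<bar>\<bar>Im z\<bar> - h\<bar> \<le> \<bar>(Im z)\<^sup>2 - h\<^sup>2\<bar> / h"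
    proof -
      have "(Im z)\<^sup>2 - h\<^sup>2 = (\<bar>Im z\<bar> - h) * (\<bar>Im z\<bar> + h)" by (simp add: algebra_simps power2_eq_square)
      hence "\<bar>(Im z)\<^sup>2 - h\<^sup>2\<bar> = \<bar>\<bar>Im z\<bar> - h\<bar> * (\<bar>Im z\<bar> + h)" using h by (simp add: abs_mult)
      moreover have "\<bar>\<bar>Im z\<bar> - h\<bar> * h \<le> \<bar>\<bar>Im z\<bar> - h\<bar> * (\<bar>Im z\<bar> + h)" by (intro mult_left_mono) auto
      ultimately show ?thesis using h by (simp add: field_simps)
    qed
    hence "cosh (k * D) * (k * \<bar>\<bar>Im z\<bar> - h\<bar>) \<le> cosh (k * D) * (k * (\<bar>(Im z)\<^sup>2 - h\<^sup>2\<bar> / h))"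
      using k by (intro mult_left_mono) auto
    also have "\<dots> = C * \<bar>((Im z)\<^sup>2 - h\<^sup>2) / 2\<bar>" by (simp add: C_def)
    finally show ?thesis by simp
  qed
  define F where "F = (\<lambda>z. cosh (of_real k * \<psi> z))"
  have "((\<lambda>t. F (cis (2 * pi * t))) has_integral F 0) {0..1}"
  proof (rule circle_mean_holomorphic)
    show "continuous_on (cball 0 1) F" unfolding F_def cosh_def by (intro continuous_intros \<psi>)
    show "F holomorphic_on ball 0 1" unfolding F_def cosh_def by (intro holomorphic_intros \<psi>)
  qed
  hence 1: "((\<lambda>t. Re (F (cis (2 * pi * t)))) has_integral 1) {0..1}"
    using has_integral_Re_complex by (force simp: F_def \<psi>(3))
  have "continuous_on {0..1} (\<lambda>t. \<psi> (cis (2 * pi * t)))"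
    by (intro continuous_on_compose2[OF \<psi>(1)] continuous_intros) auto
  hence "((\<lambda>t. C * \<bar>((Im (\<psi> (cis (2 * pi * t))))\<^sup>2 - h\<^sup>2) / 2\<bar>) has_integral
     C * integral {0..1} (\<lambda>t. \<bar>((Im (\<psi> (cis (2 * pi * t))))\<^sup>2 - h\<^sup>2) / 2\<bar>)) {0..1}"
    by (intro has_integral_mult_right integrable_integral integrable_continuous_interval continuous_intros) auto
  with 1 have "1 \<le> C * integral {0..1} (\<lambda>t. \<bar>((Im (\<psi> (cis (2 * pi * t))))\<^sup>2 - h\<^sup>2) / 2\<bar>)"
    by (rule has_integral_le) (use pw D in \<open>auto simp: F_def\<close>)
  hence "1 / C \<le> integral {0..1} (\<lambda>t. \<bar>((Im (\<psi> (cis (2 * pi * t))))\<^sup>2 - h\<^sup>2) / 2\<bar>)"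
    using C by (simp add: field_simps)
  moreover have "1 / C = h\<^sup>2 / (pi * cosh (pi * D / (2 * h)))"
    using h by (simp add: C_def k_def field_simps power2_eq_square)
  ultimately show ?thesis by simp
qed

section \<open>Torsion functions in normalised complex coordinates\<close>

text \<open>Comparison with the torsion functions of two discs: \<open>ball p r\<close> inside
  \<open>S\<close>, and the disc of radius \<open>D\<close> about 0, whose closure contains
  \<open>S\<close>. Differences of torsion functions are harmonic, so the minimum principle applies,
  at \<open>p\<close> and at 0 respectively.\<close>

lemma torsion_max_bounds:
  fixes U :: "complex \<Rightarrow> real"
  assumes S: "open S" "convex S" "bounded S" "0 \<in> S"
    and cont: "continuous_on (closure S) U" and fr: "\<And>z. z \<in> frontier S \<Longrightarrow> U z = 0"
    and g: "g holomorphic_on S" and U: "\<And>z. z \<in> S \<Longrightarrow> U z = M - (Im z)\<^sup>2 / 2 + Re (z\<^sup>2 * g z)"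
    and max: "\<And>z. z \<in> S \<Longrightarrow> U z \<le> M"
    and D: "\<And>z. z \<in> S \<Longrightarrow> cmod z \<le> D" and p: "ball p r \<subseteq> S" "0 < r"
  shows "r\<^sup>2 / 4 \<le> M" "M \<le> D\<^sup>2 / 4"
proof -
  have conn: "connected S" using S(2) by (rule convex_connected)
  have pS: "p \<in> S" using p by auto
  note mp = harmonic_minimum_principle[OF S(1) conn S(3)]
  have "0 \<le> U p - (r\<^sup>2 - (cmod (p - p))\<^sup>2) / 4"
  \<comment> \<open>The quadratic terms combine to a harmonic one: \<open>(cmod z)\<^sup>2 / 4 - (Im
    z)\<^sup>2 / 2 = Re (z\<^sup>2 / 4)\<close>.\<close>
  proof (rule mp[where V = "\<lambda>z. U z - (r\<^sup>2 - (cmod (z - p))\<^sup>2) / 4" and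
      G = "\<lambda>z. of_real M + z\<^sup>2 / 4 + z\<^sup>2 * g z - z * cnj p / 2 + of_real (((cmod p)\<^sup>2 - r\<^sup>2) / 4)"])
    show "U z - (r\<^sup>2 - (cmod (z - p))\<^sup>2) / 4 =
        Re (of_real M + z\<^sup>2 / 4 + z\<^sup>2 * g z - z * cnj p / 2 + of_real (((cmod p)\<^sup>2 - r\<^sup>2) / 4))" if "z \<in> S" for z
      unfolding U[OF that] cmod_power2 by (simp add: power2_eq_square algebra_simps diff_divide_distrib add_divide_distrib)
    show "0 \<le> U z - (r\<^sup>2 - (cmod (z - p))\<^sup>2) / 4" if "z \<in> frontier S" for z
    proof -
      have "z \<notin> S" using that by (simp add: frontier_def interior_open[OF S(1)])
      hence "r \<le> cmod (z - p)" using p(1) by (auto simp: dist_norm norm_minus_commute not_less[symmetric])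
      hence "r\<^sup>2 \<le> (cmod (z - p))\<^sup>2" using p(2) by (intro power_mono) auto
      thus ?thesis using fr[OF that] by simp
    qed
  qed (intro continuous_intros holomorphic_intros cont g pS | simp)+
  thus "r\<^sup>2 / 4 \<le> M" using max[OF pS] by simp
  have "0 \<le> D\<^sup>2 / 4 - (cmod 0)\<^sup>2 / 4 - U 0"
  proof (rule mp[where V = "\<lambda>z. D\<^sup>2 / 4 - (cmod z)\<^sup>2 / 4 - U z" and
      G = "\<lambda>z. of_real (D\<^sup>2 / 4 - M) - z\<^sup>2 / 4 - z\<^sup>2 * g z"])
    show "D\<^sup>2 / 4 - (cmod z)\<^sup>2 / 4 - U z = Re (of_real (D\<^sup>2 / 4 - M) - z\<^sup>2 / 4 - z\<^sup>2 * g z)" if "z \<in> S" for z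
      unfolding U[OF that] cmod_power2 by (simp add: power2_eq_square algebra_simps diff_divide_distrib add_divide_distrib)
    show "0 \<le> D\<^sup>2 / 4 - (cmod z)\<^sup>2 / 4 - U z" if "z \<in> frontier S" for z
    proof -
      have "S \<subseteq> cball 0 D" using D by auto
      hence "closure S \<subseteq> cball 0 D" by (rule closure_minimal) simp
      hence "cmod z \<le> D" using that by (auto simp: frontier_def)
      hence "(cmod z)\<^sup>2 \<le> D\<^sup>2" by (intro power_mono) auto
      thus ?thesis using fr[OF that] by simp
    qed
  qed (intro continuous_intros holomorphic_intros cont g S | simp)+
  thus "M \<le> D\<^sup>2 / 4" using U[OF S(4)] by simp
qed

text \<open>Two estimates for the mean of \<open>f * T\<close> are played against each other, where
  \<open>T\<close> is a product of four sines with the sign of \<open>f\<close>. The lower one comes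
  from \<open>circle_mean_times_sines_ge\<close>, the upper one from
  \<open>circle_mean_four_sines_le\<close>.\<close>

lemma torsion_flatness_ge:
  fixes U :: "complex \<Rightarrow> real"
  assumes S: "open S" "convex S" "bounded S" "0 \<in> S"
    and cont: "continuous_on (closure S) U" and fr: "\<And>z. z \<in> frontier S \<Longrightarrow> U z = 0"
    and g: "g holomorphic_on S" and U: "\<And>z. z \<in> S \<Longrightarrow> U z = M - (Im z)\<^sup>2 / 2 + Re (z\<^sup>2 * g z)"
    and D: "\<And>z. z \<in> S \<Longrightarrow> cmod z \<le> D" and h: "0 < h" "h\<^sup>2 = 2 * M" "h \<le> D"
  shows "(h\<^sup>2 / (pi * cosh (pi * D / (2 * h)))) ^ 5 / (2 * 32 ^ 4 * (D\<^sup>2 / 2) ^ 4) \<le> D\<^sup>2 * cmod (g 0) / 4"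
proof -
  have SU: "S \<noteq> UNIV" using S(3) not_bounded_UNIV by auto
  have Dp: "0 < D" using h by linarith
  obtain \<phi> \<psi> where \<psi>: "\<psi> holomorphic_on ball 0 1" and \<phi>: "\<phi> holomorphic_on S" and \<psi>0: "\<psi> 0 = 0"
    and \<psi>S: "\<And>z. z \<in> ball 0 1 \<Longrightarrow> \<psi> z \<in> S \<and> \<phi> (\<psi> z) = z"
    and \<phi>D: "\<And>w. w \<in> S \<Longrightarrow> \<phi> w \<in> ball 0 1 \<and> \<psi> (\<phi> w) = w"
    using normalized_Riemann_map[OF S(1) convex_imp_simply_connected[OF S(2)] SU S(4)] by metis
  obtain \<kappa> where \<kappa>: "\<kappa> holomorphic_on ball 0 1" "\<And>z. z \<in> ball 0 1 \<Longrightarrow> \<psi> z = z * \<kappa> z" "\<kappa> 0 = deriv \<psi> 0"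
    using holomorphic_factor_zero_at[OF \<psi> open_ball _ \<psi>0] by auto
  have \<kappa>0: "cmod (\<kappa> 0) \<le> 2 * D"
  proof -
    \<comment> \<open>Dividing by \<open>2 * D\<close> turns the weak bound \<open>D\<close> on the
      modulus of \<open>\<psi>\<close> into the strict one that the Schwarz lemma asks for.\<close>
    have "cmod (deriv (\<lambda>z. \<psi> z / of_real (2 * D)) 0) \<le> 1"
    proof (rule Schwarz_Lemma(2)[where \<xi> = 0])
      show "(\<lambda>z. \<psi> z / of_real (2 * D)) holomorphic_on ball 0 1"
        using Dp by (intro holomorphic_intros \<psi>) auto
      show "cmod (\<psi> z / of_real (2 * D)) < 1" if "cmod z < 1" for z
        using D[of "\<psi> z"] \<psi>S[of z] that Dp by (simp add: norm_divide)
    qed (use \<psi>0 in auto)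
    moreover have "deriv (\<lambda>z. \<psi> z / of_real (2 * D)) 0 = deriv \<psi> 0 / of_real (2 * D)"
      using \<psi> Dp by (intro deriv_cdivide_right) (auto simp: holomorphic_on_open field_differentiable_def)
    ultimately have "cmod (deriv \<psi> 0 / of_real (2 * D)) \<le> 1" by metis
    thus ?thesis using Dp \<kappa>(3) by (simp add: norm_divide)
  qed
  define A where "A = h\<^sup>2 / (pi * cosh (pi * D / (2 * h)))"
  have A: "0 < A" unfolding A_def using h(1) by (intro divide_pos_pos mult_pos_pos) auto
  show ?thesis unfolding A_def[symmetric]
  \<comment> \<open>On a circle of radius \<open>s < 1\<close> the function \<open>U\<close> is not
    zero but smaller than \<open>\<delta>\<close> in modulus; as
    \<open>\<bar>T\<bar> \<le> 1\<close>, this costs at most \<open>\<delta>\<close> in the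
    mean.\<close>
  proof (rule field_le_epsilon)
    fix \<delta> :: real assume \<delta>: "0 < \<delta>"
    obtain s where s: "0 < s" "s < 1" and small: "\<And>\<theta>. \<bar>U (\<psi> (of_real s * cis \<theta>))\<bar> < \<delta>"
      using uniformly_small_near_unit_circle[OF S(1,3) cont fr holomorphic_on_imp_continuous_on[OF \<phi>] _ \<psi>S \<delta>] \<phi>D
      by metis
    define \<psi>s where "\<psi>s = (\<lambda>z. \<psi> (of_real s * z))"
    have sz: "of_real s * z \<in> ball 0 1" if "z \<in> cball 0 1" for z :: complex
    proof -
      have "s * cmod z \<le> s * 1" using s that by (intro mult_left_mono) auto
      hence "s * cmod z < 1" using s by linarith
      thus ?thesis using s by (simp add: norm_mult)
    qed
    have cs: "continuous_on (cball 0 1) (\<lambda>z. F (of_real s * z))" if "F holomorphic_on ball 0 1" for F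
      using sz by (intro continuous_on_compose2[OF holomorphic_on_imp_continuous_on[OF that]] continuous_intros) auto
    have hs: "(\<lambda>z. F (of_real s * z)) holomorphic_on ball 0 1" if "F holomorphic_on ball 0 1" for F
      using sz by (intro holomorphic_on_compose_gen[OF _ that, unfolded o_def] holomorphic_intros) auto
    have \<psi>sS: "\<psi>s (cis \<theta>) \<in> S" for \<theta> using \<psi>S[OF sz] by (simp add: \<psi>s_def)
    define f where "f = (\<lambda>\<theta>. ((Im (\<psi>s (cis \<theta>)))\<^sup>2 - h\<^sup>2) / 2)"
    have cf: "continuous_on T f" for T unfolding f_def \<psi>s_def
      by (intro continuous_intros continuous_on_compose2[OF cs[OF \<psi>]]) auto
    have fB: "\<bar>f \<theta>\<bar> \<le> D\<^sup>2 / 2" for \<theta>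
    proof -
      have "\<bar>Im (\<psi>s (cis \<theta>))\<bar> \<le> D" using abs_Im_le_cmod D[OF \<psi>sS] order_trans by blast
      hence "(Im (\<psi>s (cis \<theta>)))\<^sup>2 \<le> D\<^sup>2" using Dp by (simp add: power2_le_iff_abs_le)
      moreover have "h\<^sup>2 \<le> D\<^sup>2" using h by (intro power_mono) auto
      moreover have "\<bar>(x - y) / 2\<bar> \<le> w / 2" if "0 \<le> x" "0 \<le> y" "x \<le> w" "y \<le> w" for x y w :: real
        using that by (simp add: abs_le_iff)
      ultimately show ?thesis unfolding f_def by simp
    qed
    have fA: "A \<le> integral {0..1} (\<lambda>t. \<bar>f (2 * pi * t)\<bar>)"
      unfolding A_def f_def
      by (rule circle_mean_quadratic_deviation_ge) (use cs[OF \<psi>] hs[OF \<psi>] \<psi>0 h D[OF \<psi>sS] in \<open>auto simp: \<psi>s_def\<close>)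
    note pat = convex_univalent_circle_sign_pattern[OF \<psi> \<phi> S(1,2) \<psi>S _ s]
    obtain a b where ab: "\<And>\<theta>. 0 \<le> (Im (\<psi>s (cis \<theta>)) - h) * (sin ((\<theta> - a) / 2) * sin ((b - \<theta>) / 2))"
      unfolding \<psi>s_def by (rule pat[of h]) (use \<phi>D in auto)
    obtain c d where cd: "\<And>\<theta>. 0 \<le> (Im (\<psi>s (cis \<theta>)) - (-h)) * (sin ((\<theta> - c) / 2) * sin ((d - \<theta>) / 2))"
      unfolding \<psi>s_def by (rule pat[of "-h"]) (use \<phi>D in auto)
    define T where "T = (\<lambda>\<theta>. sin ((\<theta> - a) / 2) * sin ((b - \<theta>) / 2) * (sin ((\<theta> - c) / 2) * sin ((d - \<theta>) / 2)))"
    have cT: "continuous_on X T" for X unfolding T_def by (intro continuous_intros) auto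
    have T1: "\<bar>T \<theta>\<bar> \<le> 1" for \<theta>
    proof -
      have "\<bar>T \<theta>\<bar> \<le> 1 * 1 * (1 * 1)" unfolding T_def abs_mult
        by (intro mult_mono abs_sin_le_one mult_nonneg_nonneg) auto
      thus ?thesis by simp
    qed
    \<comment> \<open>The patterns for the levels \<open>h\<close> and \<open>-h\<close> multiply to
      \<open>2 * f * T\<close>, because \<open>(y - h) * (y + h) = 2 * f\<close> for the height
      \<open>y\<close>. Reversing the arguments with \<open>b\<close> and \<open>d\<close> leaves
      absolute values unchanged.\<close>
    have fT: "\<bar>f \<theta>\<bar> * \<bar>sin ((\<theta> - a) / 2) * sin ((\<theta> - b) / 2) * sin ((\<theta> - c) / 2) * sin ((\<theta> - d) / 2)\<bar> = f \<theta> * T \<theta>" for \<theta>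
    proof -
      have flip: "\<bar>sin ((\<theta> - x) / 2)\<bar> = \<bar>sin ((x - \<theta>) / 2)\<bar>" for x
        by (metis abs_minus_cancel minus_diff_eq minus_divide_left sin_minus)
      have "0 \<le> ((Im (\<psi>s (cis \<theta>)) - h) * (sin ((\<theta> - a) / 2) * sin ((b - \<theta>) / 2))) *
         ((Im (\<psi>s (cis \<theta>)) - (-h)) * (sin ((\<theta> - c) / 2) * sin ((d - \<theta>) / 2)))"
        using ab cd by (rule mult_nonneg_nonneg)
      also have "\<dots> = 2 * (f \<theta> * T \<theta>)"
        unfolding f_def T_def by (simp add: algebra_simps power2_eq_square)
      finally have "\<bar>f \<theta> * T \<theta>\<bar> = f \<theta> * T \<theta>" by (intro abs_of_nonneg) linarith
      thus ?thesis unfolding T_def abs_mult flip[of b] flip[of d] by (simp add: mult_ac)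
    qed
    have 1: "A ^ 5 / (2 * 32 ^ 4 * (D\<^sup>2 / 2) ^ 4) \<le> integral {0..1} (\<lambda>t. f (2 * pi * t) * T (2 * pi * t))"
      using circle_mean_times_sines_ge[OF cf fB fA A, of a b c d] unfolding fT .
    \<comment> \<open>Since \<open>\<psi>s z = s * z * \<kappa> (s * z)\<close>, this is
      \<open>(\<psi>s z)\<^sup>2 * g (\<psi>s z)\<close> with the factor \<open>z\<^sup>2\<close>
      taken out.\<close>
    define G where "G = (\<lambda>z. of_real (s\<^sup>2) * (\<kappa> (of_real s * z))\<^sup>2 * g (\<psi>s z))"
    have hg: "(\<lambda>z. g (\<psi> z)) holomorphic_on ball 0 1"
      by (rule holomorphic_on_compose_gen[OF \<psi> g, unfolded o_def]) (use \<psi>S in auto)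
    have W: "Re ((cis \<theta>)\<^sup>2 * G (cis \<theta>)) = f \<theta> + U (\<psi>s (cis \<theta>))" for \<theta>
    proof -
      have "(cis \<theta>)\<^sup>2 * G (cis \<theta>) = (\<psi>s (cis \<theta>))\<^sup>2 * g (\<psi>s (cis \<theta>))"
        unfolding G_def using \<kappa>(2)[OF sz[of "cis \<theta>"]]
        by (simp add: \<psi>s_def power_mult_distrib algebra_simps)
      thus ?thesis using U[OF \<psi>sS, of \<theta>] h(2) by (simp add: f_def field_simps)
    qed
    have 2: "\<bar>integral {0..1} (\<lambda>t. Re ((cis (2 * pi * t))\<^sup>2 * G (cis (2 * pi * t))) * T (2 * pi * t))\<bar> \<le> cmod (G 0) / 16"
      unfolding T_def
    proof (rule circle_mean_four_sines_le)
      show "continuous_on (cball 0 1) G" unfolding G_def \<psi>s_def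
        by (intro continuous_intros cs[OF hg] cs[OF \<kappa>(1)])
      show "G holomorphic_on ball 0 1" unfolding G_def \<psi>s_def
        by (intro holomorphic_intros hs[OF hg] hs[OF \<kappa>(1)])
    qed
    have cG: "continuous_on {0..1} (\<lambda>t. Re ((cis (2 * pi * t))\<^sup>2 * G (cis (2 * pi * t))))"
    proof -
      have "continuous_on (cball 0 1) G" unfolding G_def \<psi>s_def
        by (intro continuous_intros cs[OF hg] cs[OF \<kappa>(1)])
      thus ?thesis by (intro continuous_intros continuous_on_compose2[where f = "\<lambda>t. cis (2 * pi * t)"]) auto
    qed
    have "integral {0..1} (\<lambda>t. f (2 * pi * t) * T (2 * pi * t)) \<le>
       integral {0..1} (\<lambda>t. Re ((cis (2 * pi * t))\<^sup>2 * G (cis (2 * pi * t))) * T (2 * pi * t) + \<delta>)"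
    proof (rule integral_le)
      fix t :: real
      have "\<bar>U (\<psi>s (cis (2 * pi * t))) * T (2 * pi * t)\<bar> \<le> \<delta> * 1"
        unfolding abs_mult using small[of "2 * pi * t"] T1 \<delta> by (intro mult_mono) (auto simp: \<psi>s_def)
      thus "f (2 * pi * t) * T (2 * pi * t) \<le>
         Re ((cis (2 * pi * t))\<^sup>2 * G (cis (2 * pi * t))) * T (2 * pi * t) + \<delta>"
        unfolding W by (simp add: algebra_simps abs_le_iff)
    next
      show "(\<lambda>t. f (2 * pi * t) * T (2 * pi * t)) integrable_on {0..1}"
        by (intro integrable_continuous_interval continuous_intros
              continuous_on_compose2[OF cf[of UNIV]] continuous_on_compose2[OF cT[of UNIV]]) auto
      show "(\<lambda>t. Re ((cis (2 * pi * t))\<^sup>2 * G (cis (2 * pi * t))) * T (2 * pi * t) + \<delta>) integrable_on {0..1}"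
        by (intro integrable_continuous_interval continuous_on_add continuous_on_mult cG continuous_on_const
              continuous_on_compose2[OF cT[of UNIV]] continuous_intros) auto
    qed
    also have "\<dots> = integral {0..1} (\<lambda>t. Re ((cis (2 * pi * t))\<^sup>2 * G (cis (2 * pi * t))) * T (2 * pi * t)) + \<delta>"
    proof -
      have "(\<lambda>t. Re ((cis (2 * pi * t))\<^sup>2 * G (cis (2 * pi * t))) * T (2 * pi * t)) integrable_on {0..1}"
        by (intro integrable_continuous_interval continuous_on_mult cG
              continuous_on_compose2[OF cT[of UNIV]] continuous_intros) auto
      thus ?thesis by (subst integral_add) auto
    qed
    finally have 3: "integral {0..1} (\<lambda>t. f (2 * pi * t) * T (2 * pi * t)) \<le> cmod (G 0) / 16 + \<delta>"
      using 2 by linarith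
    have "cmod (G 0) = s\<^sup>2 * (cmod (\<kappa> 0))\<^sup>2 * cmod (g 0)"
      by (simp add: G_def \<psi>s_def \<psi>0 norm_mult norm_power)
    also have "\<dots> \<le> 1 * (2 * D)\<^sup>2 * cmod (g 0)"
      using s \<kappa>0 by (intro mult_right_mono mult_mono power_mono power_le_one) auto
    finally have "cmod (G 0) / 16 \<le> D\<^sup>2 * cmod (g 0) / 4" by (simp add: power_mult_distrib)
    with 1 3 show "A ^ 5 / (2 * 32 ^ 4 * (D\<^sup>2 / 2) ^ 4) \<le> D\<^sup>2 * cmod (g 0) / 4 + \<delta>" by linarith
  qed
qed

text \<open>In terms of \<open>x = D / h\<close> the hypothesis bounds \<open>\<gamma>\<close> below
  by \<open>1 / (x ^ 10 * E ^ 5 * 32768 * pi ^ 5)\<close> with \<open>E = exp (pi / 2 * x)\<close>,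
  which dominates the \<open>cosh\<close>. Estimating \<open>x\<close> by \<open>exp x\<close> gives
  the 10 in the exponent, and \<open>E ^ 5\<close> gives \<open>5 * pi / 2\<close>.\<close>

lemma exponential_lower_bound:
  fixes D h \<gamma> :: real
  assumes h: "0 < h" "h \<le> D"
    and le: "(h\<^sup>2 / (pi * cosh (pi * D / (2 * h)))) ^ 5 / (2 * 32 ^ 4 * (D\<^sup>2 / 2) ^ 4) \<le> D\<^sup>2 * \<gamma> / 4"
  shows "exp (- (10 + 5 * pi / 2) * (D / h)) / (32768 * pi ^ 5) \<le> \<gamma>"
proof -
  define x where "x = D / h"
  have x: "0 < x" and D: "D = x * h" using h by (simp_all add: x_def)
  have "0 < D" using h by linarith
  have e: "pi * D / (2 * h) = pi / 2 * x" using h by (simp add: x_def)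
  define E where "E = exp (pi / 2 * x)"
  have E: "0 < E" by (simp add: E_def)
  have "exp (- (pi / 2 * x)) \<le> exp (pi / 2 * x)" using x by simp
  hence "cosh (pi / 2 * x) \<le> E" unfolding cosh_def E_def by simp
  hence "h\<^sup>2 / (pi * E) \<le> h\<^sup>2 / (pi * cosh (pi / 2 * x))"
    using cosh_real_pos[of "pi / 2 * x"] by (intro divide_left_mono mult_left_mono mult_pos_pos E) auto
  hence "(h\<^sup>2 / (pi * E)) ^ 5 \<le> (h\<^sup>2 / (pi * cosh (pi / 2 * x))) ^ 5"
    using E by (intro power_mono) auto
  hence "(h\<^sup>2 / (pi * E)) ^ 5 / (2 * 32 ^ 4 * (D\<^sup>2 / 2) ^ 4) \<le> D\<^sup>2 * \<gamma> / 4"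
    using le unfolding e by (meson divide_right_mono dual_order.trans zero_le_even_power zero_le_mult_iff even_numeral zero_le_numeral)
  hence 1: "(h\<^sup>2 / (pi * E)) ^ 5 / (2 * 32 ^ 4 * (D\<^sup>2 / 2) ^ 4) * (4 / D\<^sup>2) \<le> \<gamma>" (is "?L * _ \<le> _")
  proof -
    assume "?L \<le> D\<^sup>2 * \<gamma> / 4"
    hence "?L * (4 / D\<^sup>2) \<le> D\<^sup>2 * \<gamma> / 4 * (4 / D\<^sup>2)" by (intro mult_right_mono) auto
    thus ?thesis using \<open>0 < D\<close> by simp
  qed
  have "(h\<^sup>2 / (pi * E)) ^ 5 / (2 * 32 ^ 4 * (D\<^sup>2 / 2) ^ 4) * (4 / D\<^sup>2) = 1 / (x ^ 10 * E ^ 5 * (32768 * pi ^ 5))"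
    using h x E unfolding D by (simp add: field_simps power_mult_distrib power_divide eval_nat_numeral)
  moreover have "x ^ 10 \<le> exp x ^ 10"
    using x exp_ge_add_one_self[of x] by (intro power_mono) linarith+
  hence "x ^ 10 * E ^ 5 * (32768 * pi ^ 5) \<le> exp x ^ 10 * E ^ 5 * (32768 * pi ^ 5)"
    using E by (intro mult_right_mono) auto
  hence "1 / (exp x ^ 10 * E ^ 5 * (32768 * pi ^ 5)) \<le> 1 / (x ^ 10 * E ^ 5 * (32768 * pi ^ 5))"
    using x E by (intro divide_left_mono) auto
  moreover have "exp (- (10 + 5 * pi / 2) * (D / h)) / (32768 * pi ^ 5) = 1 / (exp x ^ 10 * E ^ 5 * (32768 * pi ^ 5))"
  proof -
    have "exp x ^ 10 * E ^ 5 = exp ((10 + 5 * pi / 2) * x)"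
      unfolding E_def by (simp flip: exp_of_nat_mult exp_add) (simp add: algebra_simps)
    moreover have "exp (- (10 + 5 * pi / 2) * (D / h)) = 1 / exp ((10 + 5 * pi / 2) * x)"
      unfolding x_def by (simp only: mult_minus_left exp_minus inverse_eq_divide)
    ultimately show ?thesis by simp
  qed
  ultimately show ?thesis using 1 by linarith
qed

text \<open>A rotation makes \<open>g 0\<close> real and nonnegative, which points the real axis
  along an eigenvector of the largest eigenvalue. The lemmas above then apply with
  \<open>h\<^sup>2 = 2 * M\<close>.\<close>

lemma convex_torsion_second_order_ge:
  fixes V :: "complex \<Rightarrow> real"
  assumes S: "open S" "convex S" "bounded S" "0 \<in> S"
    and cont: "continuous_on (closure S) V" and fr: "\<And>z. z \<in> frontier S \<Longrightarrow> V z = 0"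
    and g: "g holomorphic_on S" and V: "\<And>z. z \<in> S \<Longrightarrow> V z = M - (cmod z)\<^sup>2 / 4 + Re (z\<^sup>2 * g z)"
    and max: "\<And>z. z \<in> S \<Longrightarrow> V z \<le> M"
    and D: "\<And>z. z \<in> S \<Longrightarrow> cmod z \<le> D"
  defines "h \<equiv> sqrt (2 * M)"
  shows "0 < h" "\<And>p r. 0 < r \<Longrightarrow> ball p r \<subseteq> S \<Longrightarrow> r \<le> sqrt 2 * h"
    "cmod (g 0) \<le> 1 / 4 - exp (- (10 + 5 * pi / 2) * (D / h)) / (32768 * pi ^ 5)"
proof -
  \<comment> \<open>Half the argument, because the rotation multiplies \<open>g 0\<close> by
    \<open>\<omega>\<^sup>2\<close>.\<close>
  define \<omega> where "\<omega> = cis (- Arg (g 0) / 2)"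
  have \<omega>: "cmod \<omega> = 1" "\<omega> \<noteq> 0" by (simp_all add: \<omega>_def)
  have \<omega>g: "\<omega>\<^sup>2 * g 0 = of_real (cmod (g 0))"
  proof -
    have "\<omega>\<^sup>2 = cis (- Arg (g 0))" by (simp add: \<omega>_def power2_eq_square cis_mult)
    thus ?thesis using rcis_cmod_Arg[of "g 0"] by (metis (no_types, lifting) cis_mult cis_zero add.left_inverse mult.left_commute mult.right_neutral rcis_def)
  qed
  define S' where "S' = (\<lambda>z. \<omega> * z) -` S"
  define U where "U = (\<lambda>z. V (\<omega> * z))"
  \<comment> \<open>The \<open>1 / 4\<close> converts \<open>(cmod z)\<^sup>2 / 4\<close> into
    \<open>(Im z)\<^sup>2 / 2\<close>, their difference being
    \<open>Re (z\<^sup>2) / 4\<close>.\<close>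
  define k where "k = (\<lambda>z. \<omega>\<^sup>2 * g (\<omega> * z) - 1 / 4)"
  have oS': "open S'" unfolding S'_def by (intro open_vimage S continuous_intros)
  have S'0: "0 \<in> S'" using S(4) by (simp add: S'_def)
  have cS': "convex S'" unfolding S'_def
    by (intro convex_linear_vimage S(2) bounded_linear.linear bounded_linear_mult_right)
  have bS': "bounded S'"
  proof -
    have "cmod z \<le> D" if "z \<in> S'" for z using D[of "\<omega> * z"] that \<omega> by (simp add: S'_def norm_mult)
    thus ?thesis by (auto simp: bounded_iff)
  qed
  have clS': "\<omega> * z \<in> closure S" if "z \<in> closure S'" for z
  proof -
    have "(\<lambda>z. \<omega> * z) ` closure S' \<subseteq> closure S"
      by (rule image_closure_subset) (use closure_subset in \<open>auto intro!: continuous_intros simp: S'_def\<close>)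
    thus ?thesis using that by blast
  qed
  have cU: "continuous_on (closure S') U" unfolding U_def
    using clS' by (intro continuous_on_compose2[OF cont] continuous_intros) auto
  have frU: "U z = 0" if "z \<in> frontier S'" for z
    unfolding U_def
  proof (rule fr)
    show "\<omega> * z \<in> frontier S"
      using that clS'[of z] by (auto simp: frontier_def interior_open[OF oS'] interior_open[OF S(1)])
         (simp add: S'_def)
  qed
  have hk: "k holomorphic_on S'" unfolding k_def
    by (intro holomorphic_intros holomorphic_on_compose_gen[OF _ g, unfolded o_def]) (auto simp: S'_def)
  have Uk: "U z = M - (Im z)\<^sup>2 / 2 + Re (z\<^sup>2 * k z)" if "z \<in> S'" for z
  proof -
    have "U z = M - (cmod z)\<^sup>2 / 4 + Re (z\<^sup>2 * (\<omega>\<^sup>2 * g (\<omega> * z)))"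
      using V[of "\<omega> * z"] that \<omega>(1) by (simp add: U_def S'_def norm_mult power_mult_distrib mult_ac)
    also have "z\<^sup>2 * (\<omega>\<^sup>2 * g (\<omega> * z)) = z\<^sup>2 * k z + z\<^sup>2 / 4" by (simp add: k_def algebra_simps)
    also have "Re \<dots> = Re (z\<^sup>2 * k z) + ((Re z)\<^sup>2 - (Im z)\<^sup>2) / 4"
      by (simp add: power2_eq_square)
    finally show ?thesis unfolding cmod_power2 by (simp add: field_simps)
  qed
  have Umax: "U z \<le> M" if "z \<in> S'" for z using max that by (simp add: U_def S'_def)
  have DS': "cmod z \<le> D" if "z \<in> S'" for z using D[of "\<omega> * z"] that \<omega> by (simp add: S'_def norm_mult)
  have bnd: "r\<^sup>2 / 4 \<le> M" "M \<le> D\<^sup>2 / 4" if "ball p r \<subseteq> S'" "0 < r" for p r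
    by (rule torsion_max_bounds[OF oS' cS' bS' S'0 cU frU hk Uk Umax DS' that]; assumption)+
  obtain r0 where r0: "0 < r0" "ball 0 r0 \<subseteq> S'" by (rule openE[OF oS' S'0])
  have M: "0 < M" using bnd(1)[OF r0(2,1)] zero_less_power[OF r0(1), of 2] by linarith
  have MD: "M \<le> D\<^sup>2 / 4" using bnd(2)[OF r0(2,1)] .
  show "0 < h" using M by (simp add: h_def)
  have h: "0 < h" "h\<^sup>2 = 2 * M" using M by (simp_all add: h_def)
  have D0: "0 \<le> D" using DS'[OF S'0] by simp
  have hD: "h \<le> D"
  proof (rule power2_le_imp_le[OF _ D0])
    show "h\<^sup>2 \<le> D\<^sup>2" using MD h(2) zero_le_power2[of D] by linarith
  qed
  have k0: "k 0 = of_real (cmod (g 0) - 1 / 4)" using \<omega>g by (simp add: k_def)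
  \<comment> \<open>On the real axis \<open>U = M + t\<^sup>2 * Re (k t)\<close>, so maximality at 0
    fixes the sign of the real number \<open>k 0\<close> and hence its modulus.\<close>
  have "Re (k 0) \<le> 0"
  proof (rule Re_nonpos_at_0_if_on_right[OF _ r0(1)])
    show "isCont k 0"
      using hk oS' S'0 by (metis continuous_on_eq_continuous_at holomorphic_on_imp_continuous_on)
    show "Re (k (of_real t)) \<le> 0" if "0 < t" "t < r0" for t
    proof -
      have "of_real t \<in> S'" using r0(2) that by (auto simp: subset_iff)
      hence "t\<^sup>2 * Re (k (of_real t)) \<le> 0"
        using Uk[of "of_real t"] Umax[of "of_real t"] by (simp flip: of_real_power)
      with that show ?thesis by (simp add: mult_le_0_iff)
    qed
  qed
  hence k0': "cmod (k 0) = 1 / 4 - cmod (g 0)" unfolding k0 norm_of_real by simp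
  have "exp (- (10 + 5 * pi / 2) * (D / h)) / (32768 * pi ^ 5) \<le> cmod (k 0)"
    using torsion_flatness_ge[OF oS' cS' bS' S'0 cU frU hk Uk DS' h hD]
    by (intro exponential_lower_bound h hD) auto
  thus "cmod (g 0) \<le> 1 / 4 - exp (- (10 + 5 * pi / 2) * (D / h)) / (32768 * pi ^ 5)"
    unfolding k0' by simp
  show "r \<le> sqrt 2 * h" if r: "0 < r" "ball p r \<subseteq> S" for p r
  proof -
    have "ball (p / \<omega>) r \<subseteq> S'"
    proof
      fix z assume z: "z \<in> ball (p / \<omega>) r"
      have "dist p (\<omega> * z) = cmod \<omega> * dist (p / \<omega>) z"
        using \<omega> unfolding dist_norm norm_mult[symmetric] by (simp add: algebra_simps)
      thus "z \<in> S'" using z r \<omega> by (auto simp: S'_def subset_iff)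
    qed
    hence "r\<^sup>2 / 4 \<le> M" using bnd(1)[of "p / \<omega>" r] r(1) by simp
    hence "r\<^sup>2 \<le> (sqrt 2 * h)\<^sup>2" using h(2) by (simp add: power_mult_distrib)
    moreover have "0 \<le> sqrt 2 * h" using h(1) by simp
    ultimately show ?thesis by (rule power2_le_imp_le)
  qed
qed

section \<open>Torsion functions in complex coordinates\<close>

lemma mixed_difference_mean_value:
  fixes F F1 F12 :: "real \<Rightarrow> real \<Rightarrow> real"
  assumes t: "0 < t"
    and d1: "\<And>x y. 0 \<le> x \<Longrightarrow> x \<le> t \<Longrightarrow> 0 \<le> y \<Longrightarrow> y \<le> t \<Longrightarrow> ((\<lambda>x. F x y) has_real_derivative F1 x y) (at x)"
    and d12: "\<And>x y. 0 \<le> x \<Longrightarrow> x \<le> t \<Longrightarrow> 0 \<le> y \<Longrightarrow> y \<le> t \<Longrightarrow> (F1 x has_real_derivative F12 x y) (at y)"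
  obtains x y where "0 < x" "x < t" "0 < y" "y < t" "F t t - F t 0 - F 0 t + F 0 0 = t\<^sup>2 * F12 x y"
proof -
  have "\<exists>z>0. z < t \<and> (F t t - F t 0) - (F 0 t - F 0 0) = (t - 0) * (F1 z t - F1 z 0)"
    by (rule MVT2[OF t]) (use t in \<open>auto intro!: DERIV_diff d1\<close>)
  then obtain x where x: "0 < x" "x < t" "(F t t - F t 0) - (F 0 t - F 0 0) = t * (F1 x t - F1 x 0)" by auto
  have "\<exists>z>0. z < t \<and> F1 x t - F1 x 0 = (t - 0) * F12 x z"
    by (rule MVT2[OF t]) (use x in \<open>auto intro!: d12\<close>)
  then obtain y where y: "0 < y" "y < t" "F1 x t - F1 x 0 = t * F12 x y" by auto
  have "F t t - F t 0 - F 0 t + F 0 0 = t\<^sup>2 * F12 x y"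
    using x(3) unfolding y(3) by (simp add: power2_eq_square)
  with x y that show ?thesis by blast
qed

text \<open>The second difference of \<open>F\<close> over a square with corner \<open>z\<close> is
  \<open>t\<^sup>2\<close> times \<open>F12\<close> at one interior point and, with the variables
  exchanged, \<open>t\<^sup>2\<close> times \<open>F21\<close> at another. Both points tend to
  \<open>z\<close> as the square shrinks.\<close>

lemma mixed_partials_eq:
  fixes F F1 F2 F12 F21 :: "complex \<Rightarrow> real"
  assumes S: "open S" "z \<in> S"
    and F: "\<And>z. z \<in> S \<Longrightarrow> (F has_derivative (\<lambda>v. Re v * F1 z + Im v * F2 z)) (at z)"
    and F1: "\<And>z. z \<in> S \<Longrightarrow> (F1 has_derivative (\<lambda>v. Re v * F11 z + Im v * F12 z)) (at z)"
    and F2: "\<And>z. z \<in> S \<Longrightarrow> (F2 has_derivative (\<lambda>v. Re v * F21 z + Im v * F22 z)) (at z)"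
    and cont: "continuous_on S F12" "continuous_on S F21"
  shows "F12 z = F21 z"
proof -
  have gx: "((\<lambda>x. G (z + Complex x y)) has_real_derivative a) (at x)"
    if "(G has_derivative (\<lambda>v. Re v * a + Im v * b)) (at (z + Complex x y))" for G a b x y
  proof -
    have "((\<lambda>x. z + Complex x y) has_derivative (\<lambda>v. of_real v)) (at x)"
      unfolding Complex_eq by (auto intro!: derivative_eq_intros)
    from has_derivative_compose[OF this that] show ?thesis
      by (simp add: has_field_derivative_def mult_commute_abs)
  qed
  have gy: "((\<lambda>y. G (z + Complex x y)) has_real_derivative b) (at y)"
    if "(G has_derivative (\<lambda>v. Re v * a + Im v * b)) (at (z + Complex x y))" for G a b x y
  proof -
    have "((\<lambda>y. z + Complex x y) has_derivative (\<lambda>v. \<i> * of_real v)) (at y)"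
      unfolding Complex_eq by (auto intro!: derivative_eq_intros)
    from has_derivative_compose[OF this that] show ?thesis
      by (simp add: has_field_derivative_def mult_commute_abs)
  qed
  have "\<bar>F12 z - F21 z\<bar> \<le> 0 + \<epsilon>" if \<epsilon>: "0 < \<epsilon>" for \<epsilon>
  proof -
    have "isCont F12 z" "isCont F21 z" using cont S by (auto simp: continuous_on_eq_continuous_at)
    moreover have "0 < \<epsilon> / 2" using \<epsilon> by simp
    ultimately obtain d1 d2 where d: "0 < d1" "\<And>w. dist w z < d1 \<Longrightarrow> dist (F12 w) (F12 z) < \<epsilon> / 2"
      "0 < d2" "\<And>w. dist w z < d2 \<Longrightarrow> dist (F21 w) (F21 z) < \<epsilon> / 2"
      unfolding continuous_at_eps_delta by metis
    obtain d3 where d3: "0 < d3" "ball z d3 \<subseteq> S" using S open_contains_ball by blast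
    \<comment> \<open>Points of a square of side \<open>t\<close> are within \<open>2 * t\<close> of
      its corner, so \<open>3 * t\<close> leaves room for strict inequality.\<close>
    define t where "t = Min {d1, d2, d3} / 3"
    have t: "0 < t" "3 * t \<le> d1" "3 * t \<le> d2" "3 * t \<le> d3" using d d3 by (auto simp: t_def)
    have near: "dist (z + Complex x y) z < 3 * t" if "0 \<le> x" "x \<le> t" "0 \<le> y" "y \<le> t" for x y
      using cmod_le[of "Complex x y"] that t by (simp add: dist_norm)
    have inS: "z + Complex x y \<in> S" if "0 \<le> x" "x \<le> t" "0 \<le> y" "y \<le> t" for x y
      using near[OF that] d3(2) t(4) by (auto simp: dist_commute)
    have dF: "((\<lambda>x. F (z + Complex x y)) has_real_derivative F1 (z + Complex x y)) (at x)"
             "((\<lambda>y. F (z + Complex x y)) has_real_derivative F2 (z + Complex x y)) (at y)"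
             "((\<lambda>y. F1 (z + Complex x y)) has_real_derivative F12 (z + Complex x y)) (at y)"
             "((\<lambda>x. F2 (z + Complex x y)) has_real_derivative F21 (z + Complex x y)) (at x)"
      if "0 \<le> x" "x \<le> t" "0 \<le> y" "y \<le> t" for x y
      using gx[OF F[OF inS[OF that]]] gy[OF F[OF inS[OF that]]] gy[OF F1[OF inS[OF that]]] gx[OF F2[OF inS[OF that]]]
      by this
    obtain x y where xy: "0 < x" "x < t" "0 < y" "y < t"
      "F (z + Complex t t) - F (z + Complex t 0) - F (z + Complex 0 t) + F (z + Complex 0 0) = t\<^sup>2 * F12 (z + Complex x y)"
    proof (rule mixed_difference_mean_value[OF t(1), where F = "\<lambda>x y. F (z + Complex x y)"
          and ?F1.0 = "\<lambda>x y. F1 (z + Complex x y)" and ?F12.0 = "\<lambda>x y. F12 (z + Complex x y)"])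
    qed (rule that dF; assumption)+
    obtain x' y' where xy': "0 < x'" "x' < t" "0 < y'" "y' < t"
      "F (z + Complex t t) - F (z + Complex 0 t) - F (z + Complex t 0) + F (z + Complex 0 0) = t\<^sup>2 * F21 (z + Complex y' x')"
    proof (rule mixed_difference_mean_value[OF t(1), where F = "\<lambda>y x. F (z + Complex x y)"
          and ?F1.0 = "\<lambda>y x. F2 (z + Complex x y)" and ?F12.0 = "\<lambda>y x. F21 (z + Complex x y)"])
    qed (rule that dF; assumption)+
    have "t\<^sup>2 * F12 (z + Complex x y) = t\<^sup>2 * F21 (z + Complex y' x')" using xy(5) xy'(5) by linarith
    hence "F12 (z + Complex x y) = F21 (z + Complex y' x')" using t(1) by simp
    moreover have "dist (F12 (z + Complex x y)) (F12 z) < \<epsilon> / 2"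
      using near[of x y] xy t by (intro d(2)) linarith
    moreover have "dist (F21 (z + Complex y' x')) (F21 z) < \<epsilon> / 2"
      using near[of y' x'] xy' t by (intro d(4)) linarith
    ultimately show ?thesis unfolding dist_real_def by linarith
  qed
  hence "\<bar>F12 z - F21 z\<bar> \<le> 0" by (rule field_le_epsilon)
  thus ?thesis by simp
qed

section \<open>From the Hessian to a holomorphic function\<close>

text \<open>Adding half the identity makes \<open>A\<close> symmetric and trace-free. Its
  eigenvalues are then plus and minus the modulus of the complex number formed from its first
  row.\<close>

lemma lambda_max_trace_minus_one_le:
  fixes A :: "real ^ 2 ^ 2"
  assumes sym: "A $ 2 $ 1 = A $ 1 $ 2" and tr: "A $ 1 $ 1 + A $ 2 $ 2 = -1"
  shows "lambda_max A \<le> - 1 / 2 + cmod (Complex (A $ 1 $ 1 + 1 / 2) (A $ 1 $ 2))"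
proof -
  define p m where "p = A $ 1 $ 1" and "m = A $ 1 $ 2"
  define \<kappa> where "\<kappa> = cmod (Complex (p + 1 / 2) m)"
  have \<kappa>: "0 \<le> \<kappa>" "\<kappa>\<^sup>2 = (p + 1 / 2)\<^sup>2 + m\<^sup>2" by (simp_all add: \<kappa>_def cmod_power2)
  have ev: "A *v v = l *\<^sub>R v \<longleftrightarrow> p * v $ 1 + m * v $ 2 = l * v $ 1 \<and> m * v $ 1 + (- 1 - p) * v $ 2 = l * v $ 2" for v l
  proof -
    have "A $ 2 $ 2 = - 1 - p" using tr by (simp add: p_def)
    thus ?thesis using sym by (simp add: vec_eq_iff forall_2 matrix_vector_mult_def sum_2 p_def m_def)
  qed
  have sub: "l = - 1 / 2 + \<kappa> \<or> l = - 1 / 2 - \<kappa>" if l: "eigenvalue A l" for l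
  proof -
    obtain v where "v \<noteq> 0" "A *v v = l *\<^sub>R v" using l unfolding eigenvalue_def by blast
    hence v: "v \<noteq> 0" "p * v $ 1 + m * v $ 2 = l * v $ 1" "m * v $ 1 + (- 1 - p) * v $ 2 = l * v $ 2"
      using ev[of v l] by auto
    have "((l + 1 / 2)\<^sup>2 - \<kappa>\<^sup>2) * v $ 1 = 0" "((l + 1 / 2)\<^sup>2 - \<kappa>\<^sup>2) * v $ 2 = 0"
      unfolding \<kappa>(2) using v(2,3) by algebra+
    moreover have "v $ 1 \<noteq> 0 \<or> v $ 2 \<noteq> 0" using v(1) by (auto simp: vec_eq_iff forall_2)
    ultimately have "(l + 1 / 2)\<^sup>2 = \<kappa>\<^sup>2" by auto
    thus ?thesis by (auto simp: power2_eq_iff)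
  qed
  define l where "l = - 1 / 2 + \<kappa>"
  have l2: "m * m = (l + 1 + p) * (l - p)"
  proof -
    have "(l + 1 / 2)\<^sup>2 = (p + 1 / 2)\<^sup>2 + m\<^sup>2" using \<kappa>(2) by (simp add: l_def)
    thus ?thesis by (simp add: power2_eq_square algebra_simps)
  qed
  \<comment> \<open>An eigenvalue is exhibited so that \<open>Max\<close> is taken over a nonempty
    set. The vector \<open>(m, l - p)\<close> satisfies the first row identically and the second by
    \<open>l2\<close>; it vanishes only in the case split off, where \<open>A\<close> is
    diagonal.\<close>
  have "eigenvalue A l"
  proof (cases "m = 0 \<and> l = p")
    case True
    show ?thesis unfolding eigenvalue_def ev
      by (rule exI[of _ "vector [1, 0]"]) (use True in \<open>auto simp: vec_eq_iff forall_2\<close>)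
  next
    case False
    show ?thesis unfolding eigenvalue_def ev
      by (rule exI[of _ "vector [m, l - p]"]) (use False l2 in \<open>auto simp: vec_eq_iff forall_2 algebra_simps\<close>)
  qed
  hence "{l. eigenvalue A l} \<noteq> {}" by auto
  moreover have "{l. eigenvalue A l} \<subseteq> {- 1 / 2 + \<kappa>, - 1 / 2 - \<kappa>}" using sub by auto
  moreover from this have "finite {l. eigenvalue A l}" by (rule finite_subset) simp
  ultimately have "Max {l. eigenvalue A l} \<le> - 1 / 2 + \<kappa>" using \<kappa>(1) by (subst Max_le_iff) auto
  thus ?thesis unfolding lambda_max_def \<kappa>_def p_def m_def .
qed

lemma has_derivative_partial_derivs:
  fixes f :: "real ^ 2 \<Rightarrow> real"
  assumes "f differentiable (at x)"
  shows "(f has_derivative (\<lambda>v. v $ 1 * partial_deriv 1 f x + v $ 2 * partial_deriv 2 f x)) (at x)"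
proof -
  let ?D = "frechet_derivative f (at x)"
  have D: "(f has_derivative ?D) (at x)" using assms by (simp add: frechet_derivative_works)
  interpret linear ?D using D has_derivative_linear by blast
  have "?D v = v $ 1 * partial_deriv 1 f x + v $ 2 * partial_deriv 2 f x" for v
  proof -
    have "v = v $ 1 *\<^sub>R axis 1 1 + v $ 2 *\<^sub>R axis 2 1"
      by (auto simp: vec_eq_iff forall_2 axis_def)
    hence "?D v = ?D (v $ 1 *\<^sub>R axis 1 1 + v $ 2 *\<^sub>R axis 2 1)" by simp
    also have "\<dots> = v $ 1 * partial_deriv 1 f x + v $ 2 * partial_deriv 2 f x"
      by (simp add: add scale partial_deriv_def)
    finally show ?thesis .
  qed
  hence "?D = (\<lambda>v. v $ 1 * partial_deriv 1 f x + v $ 2 * partial_deriv 2 f x)" by auto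
  with D show ?thesis by simp
qed

text \<open>The Cauchy-Riemann equations for \<open>p - \<i> * q\<close>. When \<open>p\<close> and
  \<open>q\<close> are the partial derivatives of a harmonic function, this is the complex
  derivative of a holomorphic function with that real part.\<close>

lemma has_real_partials_imp_field_derivative:
  fixes p q :: "complex \<Rightarrow> real"
  assumes p: "(p has_derivative (\<lambda>v. Re v * a + Im v * b)) (at z)"
    and q: "(q has_derivative (\<lambda>v. Re v * b - Im v * a)) (at z)"
  shows "((\<lambda>z. Complex (p z) (- q z)) has_field_derivative Complex a (- b)) (at z)"
proof -
  have "((\<lambda>z. of_real (p z) - \<i> * of_real (q z)) has_derivative
      (\<lambda>v. of_real (Re v * a + Im v * b) - \<i> * of_real (Re v * b - Im v * a))) (at z)"
    by (rule derivative_intros p q)+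
  moreover have "(\<lambda>z. complex_of_real (p z) - \<i> * of_real (q z)) = (\<lambda>z. Complex (p z) (- q z))"
    by (auto simp: complex_eq_iff)
  moreover have "(\<lambda>v. complex_of_real (Re v * a + Im v * b) - \<i> * of_real (Re v * b - Im v * a)) = (*) (Complex a (- b))"
    by (rule ext) (simp add: complex_eq_iff algebra_simps)
  ultimately show ?thesis unfolding has_field_derivative_def by metis
qed

text \<open>An isometry of the complex plane onto \<open>real ^ 2\<close> with \<open>a\<close> at
  the origin. The axes stay fixed here; \<open>convex_torsion_second_order_ge\<close> rotates
  them.\<close>

definition complex_chart :: "real ^ 2 \<Rightarrow> complex \<Rightarrow> real ^ 2" where
  "complex_chart a z = a + vector [Re z, Im z]"

lemma complex_chart_0 [simp]: "complex_chart a 0 = a"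
  by (auto simp: complex_chart_def vec_eq_iff forall_2)

lemma dist_complex_chart: "dist (complex_chart a z) (complex_chart a w) = cmod (z - w)"
  by (simp add: complex_chart_def dist_norm norm_vec_def L2_set_def sum_2 cmod_def)

lemma complex_chart_surj:
  obtains z where "complex_chart a z = x"
proof
  show "complex_chart a (Complex ((x - a) $ 1) ((x - a) $ 2)) = x"
    by (auto simp: complex_chart_def vec_eq_iff forall_2)
qed

lemma continuous_on_complex_chart: "continuous_on X (complex_chart a)"
  unfolding continuous_on_iff dist_complex_chart by (metis dist_norm)

lemma open_complex_chart_vimage: "open \<Omega> \<Longrightarrow> open (complex_chart a -` \<Omega>)"
  by (intro open_vimage continuous_on_complex_chart)

lemma convex_complex_chart_vimage:
  assumes "convex \<Omega>"
  shows "convex (complex_chart a -` \<Omega>)"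
proof (rule convexI)
  fix x y :: complex and s t :: real
  assume xy: "x \<in> complex_chart a -` \<Omega>" "y \<in> complex_chart a -` \<Omega>" and st: "0 \<le> s" "0 \<le> t" "s + t = 1"
  have "s *\<^sub>R complex_chart a x + t *\<^sub>R complex_chart a y =
      (s + t) *\<^sub>R a + vector [Re (s *\<^sub>R x + t *\<^sub>R y), Im (s *\<^sub>R x + t *\<^sub>R y)]"
    by (auto simp: complex_chart_def vec_eq_iff forall_2 algebra_simps)
  hence "complex_chart a (s *\<^sub>R x + t *\<^sub>R y) = s *\<^sub>R complex_chart a x + t *\<^sub>R complex_chart a y"
    using st by (simp add: complex_chart_def)
  thus "s *\<^sub>R x + t *\<^sub>R y \<in> complex_chart a -` \<Omega>" using convexD[OF assms _ _ st] xy by simp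
qed

lemma has_derivative_complex_chart:
  "(complex_chart a has_derivative (\<lambda>v. vector [Re v, Im v])) (at z)"
proof -
  have "bounded_linear (\<lambda>z. vector [Re z, Im z] :: real ^ 2)"
    by (rule linear_conv_bounded_linear[THEN iffD1], rule linearI) (auto simp: vec_eq_iff forall_2)
  thus ?thesis
    unfolding complex_chart_def by (auto intro!: derivative_eq_intros bounded_linear_imp_has_derivative)
qed

text \<open>Adding \<open>(cmod z)\<^sup>2 / 4\<close> to \<open>u\<close> gives a harmonic
  function, locally the real part of a holomorphic \<open>F\<close>, globally so by convexity. The
  gradient vanishes at the maximum, so \<open>F - F 0\<close> has a double zero, and
  \<open>deriv (deriv F) 0 = 2 * g 0\<close> has the modulus that occurs in the eigenvalue
  bound.\<close>

lemma torsion_function_complex_form: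
  fixes u :: "real ^ 2 \<Rightarrow> real" and x0 :: "real ^ 2"
  assumes \<Omega>: "open \<Omega>" "convex \<Omega>" and u: "torsion_function \<Omega> u"
    and x0: "x0 \<in> \<Omega>" and max: "\<And>x. x \<in> \<Omega> \<Longrightarrow> u x \<le> u x0"
  obtains g where "g holomorphic_on complex_chart x0 -` \<Omega>"
    "\<And>z. complex_chart x0 z \<in> \<Omega> \<Longrightarrow>
       u (complex_chart x0 z) = u x0 - (cmod z)\<^sup>2 / 4 + Re (z\<^sup>2 * g z)"
    "lambda_max (hessian u x0) \<le> - 1 / 2 + 2 * cmod (g 0)"
proof -
  define P where "P = complex_chart x0"
  let ?S = "P -` \<Omega>"
  let ?u1 = "partial_deriv 1 u" and ?u2 = "partial_deriv 2 u"
  have P0: "P 0 = x0" by (simp add: P_def)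
  note dP = has_derivative_complex_chart[of x0, folded P_def]
  note cP = continuous_on_complex_chart[of _ x0, folded P_def]
  note oS = open_complex_chart_vimage[OF \<Omega>(1), of x0, folded P_def]
  note cS = convex_complex_chart_vimage[OF \<Omega>(2), of x0, folded P_def]
  have S0: "0 \<in> ?S" using x0 P0 by simp
  have C2: "C2_on \<Omega> u" and lap: "\<And>x. x \<in> \<Omega> \<Longrightarrow> laplacian u x = - 1"
    using u by (auto simp: torsion_function_def minus_equation_iff[of _ 1])
  have C1: "C1_on \<Omega> u" "C1_on \<Omega> ?u1" "C1_on \<Omega> ?u2" using C2 by (auto simp: C2_on_def)
  have dVP: "((\<lambda>z. f (P z)) has_derivative (\<lambda>v. Re v * partial_deriv 1 f (P z) + Im v * partial_deriv 2 f (P z))) (at z)"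
    if "C1_on \<Omega> f" "z \<in> ?S" for f z
  proof -
    have "f differentiable (at (P z))" using that by (auto simp: C1_on_def)
    from has_derivative_compose[OF dP has_derivative_partial_derivs[OF this]] show ?thesis by simp
  qed
  have cpd: "continuous_on ?S (\<lambda>z. partial_deriv i f (P z))" if "C1_on \<Omega> f" for f i
    using that by (intro continuous_on_compose2[OF _ cP]) (auto simp: C1_on_def)
  have mixed: "partial_deriv 2 ?u1 (P z) = partial_deriv 1 ?u2 (P z)" if "z \<in> ?S" for z
    by (rule mixed_partials_eq[OF oS that, where F = "\<lambda>z. u (P z)" and ?F1.0 = "\<lambda>z. ?u1 (P z)" and ?F2.0 = "\<lambda>z. ?u2 (P z)"
          and ?F12.0 = "\<lambda>z. partial_deriv 2 ?u1 (P z)" and ?F21.0 = "\<lambda>z. partial_deriv 1 ?u2 (P z)"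
          and ?F11.0 = "\<lambda>z. partial_deriv 1 ?u1 (P z)" and ?F22.0 = "\<lambda>z. partial_deriv 2 ?u2 (P z)"])
       (intro dVP C1 cpd; assumption)+
  have tr: "partial_deriv 1 ?u1 (P z) + partial_deriv 2 ?u2 (P z) = - 1" if "z \<in> ?S" for z
    using lap[of "P z"] that by (simp add: laplacian_def sum_2)
  \<comment> \<open>The conjugate gradient of \<open>u + (cmod z)\<^sup>2 / 4\<close>; it is
    holomorphic by the torsion equation and the symmetry of mixed partials.\<close>
  define f where "f = (\<lambda>z. Complex (?u1 (P z) + Re z / 2) (- (?u2 (P z) + Im z / 2)))"
  define f' where "f' = (\<lambda>z. Complex (partial_deriv 1 ?u1 (P z) + 1 / 2) (- partial_deriv 2 ?u1 (P z)))"
  have df: "(f has_field_derivative f' z) (at z)" if z: "z \<in> ?S" for z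
    unfolding f_def f'_def
  proof (rule has_real_partials_imp_field_derivative)
    show "((\<lambda>z. ?u1 (P z) + Re z / 2) has_derivative
        (\<lambda>v. Re v * (partial_deriv 1 ?u1 (P z) + 1 / 2) + Im v * partial_deriv 2 ?u1 (P z))) (at z)"
      by (auto intro!: derivative_eq_intros dVP[OF C1(2) z] simp: algebra_simps)
    have 22: "partial_deriv 2 ?u2 (P z) = - 1 - partial_deriv 1 ?u1 (P z)" using tr[OF z] by simp
    show "((\<lambda>z. ?u2 (P z) + Im z / 2) has_derivative
        (\<lambda>v. Re v * partial_deriv 2 ?u1 (P z) - Im v * (partial_deriv 1 ?u1 (P z) + 1 / 2))) (at z)"
      unfolding mixed[OF z]
      by (auto intro!: derivative_eq_intros dVP[OF C1(3) z] simp: 22 algebra_simps)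
  qed
  have hf: "f holomorphic_on ?S" using df oS by (auto simp: holomorphic_on_open)
  obtain F where F: "\<And>z. z \<in> ?S \<Longrightarrow> (F has_field_derivative f z) (at z)"
    using holomorphic_convex_primitive'[OF cS oS hf] oS by (metis at_within_open)
  have hF: "F holomorphic_on ?S" using F oS by (auto simp: holomorphic_on_open)
  have dF: "deriv F z = f z" if "z \<in> ?S" for z using F[OF that] by (rule DERIV_imp_deriv)
  have grad0: "f 0 = 0"
  proof -
    have "u differentiable (at x0)" using C1(1) x0 by (simp add: C1_on_def)
    from has_derivative_partial_derivs[OF this]
    have "(\<lambda>v. (v :: real ^ 2) $ 1 * ?u1 x0 + v $ 2 * ?u2 x0) = (\<lambda>v. 0)"
      by (rule differential_zero_maxmin[OF x0 \<Omega>(1)]) (use max in auto)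
    from fun_cong[OF this, of "axis 1 1"] fun_cong[OF this, of "axis 2 1"]
    show ?thesis by (simp add: f_def P0 axis_def complex_eq_iff)
  qed
  obtain g where g: "g holomorphic_on ?S" "\<And>z. z \<in> ?S \<Longrightarrow> F z = F 0 + z\<^sup>2 * g z" "deriv (deriv F) 0 = 2 * g 0"
    using holomorphic_factor_double_zero[OF hF oS S0] dF[OF S0] grad0 by metis
  have const: "u (P z) + (cmod z)\<^sup>2 / 4 - Re (F z) = u (P 0) + (cmod 0)\<^sup>2 / 4 - Re (F 0)" if z: "z \<in> ?S" for z
  proof -
    have "\<exists>c. \<forall>z\<in>?S. u (P z) + (cmod z)\<^sup>2 / 4 - Re (F z) = c"
    proof (rule has_derivative_zero_constant[OF cS])
      fix w assume w: "w \<in> ?S"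
      have "((\<lambda>z. Re (F z)) has_derivative (\<lambda>v. Re (f w * v))) (at w)"
        using F[OF w] unfolding has_field_derivative_def by (rule bounded_linear.has_derivative[OF bounded_linear_Re])
      note dRF = this
      have dsq: "((\<lambda>z. ((Re z)\<^sup>2 + (Im z)\<^sup>2) / 4) has_derivative (\<lambda>v. (Re w * Re v + Im w * Im v) / 2)) (at w)"
        by (auto intro!: derivative_eq_intros simp: field_simps)
      have "((\<lambda>z. u (P z) + ((Re z)\<^sup>2 + (Im z)\<^sup>2) / 4 - Re (F z)) has_derivative
          (\<lambda>v. Re v * ?u1 (P w) + Im v * ?u2 (P w) + (Re w * Re v + Im w * Im v) / 2 - Re (f w * v))) (at w)"
        by (intro has_derivative_diff has_derivative_add dVP[OF C1(1) w] dsq dRF)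
      moreover have "(\<lambda>v. Re v * ?u1 (P w) + Im v * ?u2 (P w) + (Re w * Re v + Im w * Im v) / 2 - Re (f w * v)) = (\<lambda>v. 0)"
        by (rule ext) (simp add: f_def field_simps)
      ultimately have "((\<lambda>z. u (P z) + ((Re z)\<^sup>2 + (Im z)\<^sup>2) / 4 - Re (F z)) has_derivative (\<lambda>v. 0)) (at w)"
        by simp
      thus "((\<lambda>z. u (P z) + (cmod z)\<^sup>2 / 4 - Re (F z)) has_derivative (\<lambda>v. 0)) (at w within ?S)"
        unfolding cmod_power2 by (rule has_derivative_at_withinI)
    qed
    thus ?thesis using z S0 by metis
  qed
  have "deriv (deriv F) 0 = f' 0"
  proof (rule DERIV_imp_deriv)
    show "(deriv F has_field_derivative f' 0) (at 0)"
      by (rule has_field_derivative_transform_within_open[OF df[OF S0] oS S0]) (simp add: dF)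
  qed
  hence g0: "2 * g 0 = f' 0" using g(3) by simp
  show ?thesis
  proof (rule that[OF g(1)[unfolded P_def]])
    show "u (complex_chart x0 z) = u x0 - (cmod z)\<^sup>2 / 4 + Re (z\<^sup>2 * g z)"
      if "complex_chart x0 z \<in> \<Omega>" for z
      using const[of z] g(2)[of z] that P0 by (simp add: P_def)
    have "lambda_max (hessian u x0) \<le> - 1 / 2 + cmod (Complex (hessian u x0 $ 1 $ 1 + 1 / 2) (hessian u x0 $ 1 $ 2))"
      using mixed[OF S0] tr[OF S0] by (intro lambda_max_trace_minus_one_le) (simp_all add: hessian_def P0)
    also have "cmod (Complex (hessian u x0 $ 1 $ 1 + 1 / 2) (hessian u x0 $ 1 $ 2)) = cmod (f' 0)"
      using mixed[OF S0] by (simp add: f'_def hessian_def P0 cmod_def)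
    also have "\<dots> = 2 * cmod (g 0)" unfolding g0[symmetric] by (simp add: norm_mult)
    finally show "lambda_max (hessian u x0) \<le> - 1 / 2 + 2 * cmod (g 0)" .
  qed
qed

section \<open>Passage to diameter and inradius\<close>

theorem theorem1:
  shows "\<exists>c1 c2 :: real. c1 > 0 \<and> c2 > 0 \<and>
    (\<forall>(\<Omega> :: (real ^ 2) set) (u :: real ^ 2 \<Rightarrow> real) (x0 :: real ^ 2).
       planar_domain \<Omega> \<longrightarrow> bounded \<Omega> \<longrightarrow> convex \<Omega> \<longrightarrow>
       torsion_function \<Omega> u \<longrightarrow>
       x0 \<in> \<Omega> \<longrightarrow> (\<forall>x\<in>closure \<Omega>. u x \<le> u x0) \<longrightarrow>
       lambda_max (hessian u x0) \<le> - c1 * exp (- c2 * (diameter \<Omega> / inrad \<Omega>)))"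
proof (intro exI conjI allI impI)
  \<comment> \<open>The 2 in \<open>- 1 / 2 + 2 * cmod (g 0)\<close> halves the 32768 of the
    second-order estimate, and \<open>inrad \<Omega> \<le> sqrt 2 * h\<close> brings
    \<open>sqrt 2\<close> into the exponent.\<close>
  show "0 < 1 / (16384 * pi ^ 5)" "0 < (10 + 5 * pi / 2) * sqrt 2" by (auto intro!: mult_pos_pos add_pos_pos)
  fix \<Omega> :: "(real ^ 2) set" and u :: "real ^ 2 \<Rightarrow> real" and x0 :: "real ^ 2"
  assume "planar_domain \<Omega>" and bd: "bounded \<Omega>" and conv: "convex \<Omega>" and tors: "torsion_function \<Omega> u"
    and x0: "x0 \<in> \<Omega>" and max: "\<forall>x\<in>closure \<Omega>. u x \<le> u x0"
  hence op: "open \<Omega>" by (simp add: planar_domain_def)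
  define P where "P = complex_chart x0"
  define S where "S = P -` \<Omega>"
  have max': "u x \<le> u x0" if "x \<in> \<Omega>" for x using max that closure_subset by blast
  obtain g where g: "g holomorphic_on S"
    and ug: "\<And>z. z \<in> S \<Longrightarrow> u (P z) = u x0 - (cmod z)\<^sup>2 / 4 + Re (z\<^sup>2 * g z)"
    and lam: "lambda_max (hessian u x0) \<le> - 1 / 2 + 2 * cmod (g 0)"
    using torsion_function_complex_form[OF op conv tors x0 max'] unfolding S_def P_def vimage_eq by blast
  have P0: "P 0 = x0" by (simp add: P_def)
  note dist_P = dist_complex_chart[of x0, folded P_def]
  note cP = continuous_on_complex_chart[of _ x0, folded P_def]
  note oS = open_complex_chart_vimage[OF op, of x0, folded P_def, folded S_def]
  note cS = convex_complex_chart_vimage[OF conv, of x0, folded P_def, folded S_def]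
  have S0: "0 \<in> S" using x0 P0 by (simp add: S_def)
  have D: "cmod z \<le> diameter \<Omega>" if "z \<in> S" for z
    using diameter_bounded_bound[OF bd _ x0, of "P z"] that dist_P[of z 0] by (simp add: S_def P0)
  have bS: "bounded S" using D by (auto simp: bounded_iff)
  have clS: "P z \<in> closure \<Omega>" if "z \<in> closure S" for z
  proof -
    have "P ` closure S \<subseteq> closure \<Omega>"
      by (rule image_closure_subset[OF cP]) (use closure_subset in \<open>auto simp: S_def\<close>)
    thus ?thesis using that by blast
  qed
  define h where "h = sqrt (2 * u x0)"
  have contV: "continuous_on (closure S) (\<lambda>z. u (P z))"
    using tors clS by (intro continuous_on_compose2[OF _ cP]) (auto simp: torsion_function_def)
  have frV: "u (P z) = 0" if "z \<in> frontier S" for z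
  proof -
    have "P z \<in> frontier \<Omega>"
      using that clS[of z] by (auto simp: frontier_def interior_open[OF oS] interior_open[OF op])
        (simp add: S_def)
    thus ?thesis using tors by (simp add: torsion_function_def)
  qed
  have maxV: "u (P z) \<le> u x0" if "z \<in> S" for z using max' that by (simp add: S_def)
  note main = convex_torsion_second_order_ge[OF oS cS bS S0 contV frV g ug maxV D, folded h_def]
  have h: "0 < h" "\<And>p r. 0 < r \<Longrightarrow> ball p r \<subseteq> S \<Longrightarrow> r \<le> sqrt 2 * h"
    and g0: "cmod (g 0) \<le> 1 / 4 - exp (- (10 + 5 * pi / 2) * (diameter \<Omega> / h)) / (32768 * pi ^ 5)"
    by (rule main; assumption)+
  let ?R = "{r. r > 0 \<and> (\<exists>c. ball c r \<subseteq> \<Omega>)}"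
  have R: "r \<le> sqrt 2 * h" if rR: "r \<in> ?R" for r
  proof -
    obtain c where c: "0 < r" "ball c r \<subseteq> \<Omega>" using rR by blast
    obtain p where p: "P p = c" using complex_chart_surj unfolding P_def by blast
    have "ball p r \<subseteq> S" using c(2) dist_P[of p] by (auto simp: S_def p subset_iff dist_norm)
    thus ?thesis using h(2) c(1) by blast
  qed
  \<comment> \<open>A disc about \<open>x0\<close> makes the set of admissible radii nonempty, so
    that its supremum is bounded by \<open>sqrt 2 * h\<close> and is positive.\<close>
  obtain e where e: "0 < e" "ball x0 e \<subseteq> \<Omega>" using op x0 open_contains_ball by blast
  hence eR: "e \<in> ?R" by blast
  have inr: "inrad \<Omega> \<le> sqrt 2 * h" unfolding inrad_def using eR R by (intro cSup_least) auto
  have "e \<le> inrad \<Omega>" unfolding inrad_def using eR R by (intro cSup_upper bdd_aboveI) auto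
  hence inr0: "0 < inrad \<Omega>" using e by linarith
  have "diameter \<Omega> / h = sqrt 2 * (diameter \<Omega> / (sqrt 2 * h))" by simp
  also have "\<dots> \<le> sqrt 2 * (diameter \<Omega> / inrad \<Omega>)"
    using inr inr0 diameter_ge_0[OF bd] h(1) by (intro mult_left_mono divide_left_mono) auto
  finally have "(10 + 5 * pi / 2) * (diameter \<Omega> / h) \<le> (10 + 5 * pi / 2) * (sqrt 2 * (diameter \<Omega> / inrad \<Omega>))"
    by (intro mult_left_mono) auto
  hence "exp (- ((10 + 5 * pi / 2) * sqrt 2) * (diameter \<Omega> / inrad \<Omega>)) \<le> exp (- (10 + 5 * pi / 2) * (diameter \<Omega> / h))"
    by (simp only: exp_le_cancel_iff mult.assoc mult_minus_left neg_le_iff_le)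
  hence "exp (- ((10 + 5 * pi / 2) * sqrt 2) * (diameter \<Omega> / inrad \<Omega>)) / (32768 * pi ^ 5)
      \<le> exp (- (10 + 5 * pi / 2) * (diameter \<Omega> / h)) / (32768 * pi ^ 5)"
    by (intro divide_right_mono) auto
  with lam g0 have "lambda_max (hessian u x0) \<le>
      - 2 * (exp (- ((10 + 5 * pi / 2) * sqrt 2) * (diameter \<Omega> / inrad \<Omega>)) / (32768 * pi ^ 5))" by linarith
  also have "\<dots> = - (1 / (16384 * pi ^ 5)) * exp (- ((10 + 5 * pi / 2) * sqrt 2) * (diameter \<Omega> / inrad \<Omega>))"
    by simp
  finally show "lambda_max (hessian u x0) \<le>
      - (1 / (16384 * pi ^ 5)) * exp (- ((10 + 5 * pi / 2) * sqrt 2) * (diameter \<Omega> / inrad \<Omega>))" .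
qed

end
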